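(* Let $(N_i)_{i\ge0}$ be the integer sequence defined in the context and let $k$ be an integer. Define $j$ as the integer such that $k\in[N_j,N_{j+1})$. If $k\neq N_j$, then the dominant radicand of $H_{\le k}(z)$ is the $j$-th radicand $R_{j,k}$ (counted from the innermost one outwards), and the dominant singularity $\rho_k$ of $H_{\le k}(z)$ is of type $\frac12$. Otherwise (that is, if $k=N_j$), the $j$-th and the $(j+1)$-st radicand vanish simultaneously at the dominant singularity of $H_{\le k}(z)$, which is equal to $\frac{1}{2u_j}$ and of type $\frac14$.
   Context: The integer sequences are $u_0=0$, $u_{i+1}=u_i^2+i+1$ for $i\ge0$, and $N_i=u_i^2-u_i+i$ for $i\ge 0$. A closed lambda-term (up to $\alpha$-equivalence) is a Motzkin tree (finite plane rooted tree, each node having 0, 1 or 2 children) together with a map assigning to every leaf one unary node on the path from the root to that leaf. Its size is the number of nodes; its unary height is the maximum over vertices $v$ of the number of unary nodes on the path from the root to $v$. $H_{\le k}(z)$ is the generating function by size of closed lambda-terms of unary height at most $k$. One has $H_{\le k}(z)=\frac{1-\sqrt{R_{k+1,k}(z)}}{2z}$, where the radicands, numbered from the innermost outwards, are defined by $R_{1,k}(z)=1-4kz^2$ and $R_{i,k}(z)=1-4(k-i+1)z^2-2z+2z\sqrt{R_{i-1,k}(z)}$ for $2\le i\le k+1$. A function $f$ has a singularity of type $\alpha$ at $z=\rho$ if there is a constant $c$ such that $f(z)\sim c\,(1-z/\rho)^{\alpha}$ as $z\to\rho$ inside the domain of analyticity of $f$. The dominant singularities of a function $f$ analytic at $0$ are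 those singularities on the circle of convergence of its Taylor series at $0$ which are of smallest type. The $i$-th radicand is called dominant if it has a zero at a dominant singularity of $H_{\le k}(z)$.
   Formalization: For k≠N_j the dominant radicand is proved to be the (j+1)-st, not the j-th (which fails, e.g. for k=2); k≥1 is assumed because 1/(2u_0) is undefined; type α is taken after subtracting a function analytic at ρ, since read literally the type would be 0. *)

theory Defs
  imports "HOL-Complex_Analysis.Complex_Analysis" "HOL-Library.Landau_Symbols"
begin

fun u_seq :: "nat \<Rightarrow> nat" where
  "u_seq 0 = 0"
| "u_seq (Suc i) = (u_seq i)\<^sup>2 + i + 1"

(* The subtraction on nat does not truncate, since m\<^sup>2 \<ge> m. *)
definition N_seq :: "nat \<Rightarrow> nat" where
  "N_seq i = (u_seq i)\<^sup>2 - u_seq i + i"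

(* Motzkin trees whose leaves carry de Bruijn indices: Var i points to the (i+1)-st unary node
   met on the way from the leaf up to the root.  In a closed term this index is the same datum as
   a unary node on the path from the root to the leaf. *)
datatype lterm = Var nat | Lam lterm | App lterm lterm

(* All indices of t point to unary nodes of t once t is placed below m further unary nodes. *)
fun closed_under :: "nat \<Rightarrow> lterm \<Rightarrow> bool" where
  "closed_under m (Var i) \<longleftrightarrow> i < m"
| "closed_under m (Lam t) \<longleftrightarrow> closed_under (Suc m) t"
| "closed_under m (App s t) \<longleftrightarrow> closed_under m s \<and> closed_under m t"

fun node_count :: "lterm \<Rightarrow> nat" where
  "node_count (Var i) = 1"
| "node_count (Lam t) = 1 + node_count t"
| "node_count (App s t) = 1 + node_count s + node_count t"

fun unary_height :: "lterm \<Rightarrow> nat" where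
  "unary_height (Var i) = 0"
| "unary_height (Lam t) = 1 + unary_height t"
| "unary_height (App s t) = max (unary_height s) (unary_height t)"

definition H_le :: "nat \<Rightarrow> complex fps" where
  "H_le k = Abs_fps (\<lambda>n. of_nat (card {t. closed_under 0 t \<and> unary_height t \<le> k \<and> node_count t = n}))"

(* radicand k i is the radicand with index i \<ge> 1, counted from the innermost one; the value at
   i = 0 is a dummy.  The coefficient below is k - i + 1 for the index i + 2 of the left-hand side. *)
fun radicand :: "nat \<Rightarrow> nat \<Rightarrow> complex \<Rightarrow> complex" where
  "radicand k 0 z = 1"
| "radicand k (Suc 0) z = 1 - 4 * of_nat k * z\<^sup>2"
| "radicand k (Suc (Suc i)) z =
     1 - 4 * (of_nat k - of_nat (Suc (Suc i)) + 1) * z\<^sup>2 - 2 * z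
       + 2 * z * csqrt (radicand k (Suc i) z)"

(* The disc of convergence together with a neighbourhood of \<rho> slit along the ray from \<rho> away
   from 0, i.e. the part near \<rho> on which the principal branch of (1 - z/\<rho>) powr \<alpha> is
   analytic. *)
definition slit_domain :: "complex \<Rightarrow> real \<Rightarrow> complex set" where
  "slit_domain \<rho> \<epsilon> = ball 0 (norm \<rho>) \<union> (ball \<rho> \<epsilon> - {of_real t * \<rho> |t. t \<ge> 1})"

(* The power series F has a singularity of type \<alpha> at the point \<rho> of its circle of convergence:
   F continues to f on a slit domain and f(z) ~ c (1 - z/\<rho>)^\<alpha> there, up to a function g
   analytic at \<rho>.  A regular part has to be allowed, since a series such as 1 - (1 - z)^(1/2),
   which is of type 1/2, has a nonzero limit at its singularity.  As c \<noteq> 0 and \<alpha> is not a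
   natural number, \<alpha> is unique and \<rho> is not a regular point. *)
definition has_singularity_type :: "complex fps \<Rightarrow> complex \<Rightarrow> real \<Rightarrow> bool" where
  "has_singularity_type F \<rho> \<alpha> \<longleftrightarrow>
     \<rho> \<noteq> 0 \<and> fps_conv_radius F = ereal (norm \<rho>) \<and> \<alpha> \<notin> \<nat> \<and>
     (\<exists>\<epsilon> f g c. \<epsilon> > 0 \<and> f holomorphic_on slit_domain \<rho> \<epsilon> \<and>
        (\<forall>z\<in>ball 0 (norm \<rho>). f z = eval_fps F z) \<and>
        g analytic_on {\<rho>} \<and> c \<noteq> 0 \<and>
        (\<lambda>z. f z - g z) \<sim>[at \<rho> within slit_domain \<rho> \<epsilon>]
          (\<lambda>z. c * (1 - z / \<rho>) powr of_real \<alpha>))"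

definition dominant_singularity :: "complex fps \<Rightarrow> complex \<Rightarrow> bool" where
  "dominant_singularity F \<rho> \<longleftrightarrow>
     (\<exists>\<alpha>. has_singularity_type F \<rho> \<alpha> \<and> (\<forall>\<rho>' \<beta>. has_singularity_type F \<rho>' \<beta> \<longrightarrow> \<alpha> \<le> \<beta>))"

definition dominant_radicand :: "nat \<Rightarrow> nat \<Rightarrow> bool" where
  "dominant_radicand k i \<longleftrightarrow>
     i \<in> {1..k + 1} \<and> (\<exists>\<rho>. dominant_singularity (H_le k) \<rho> \<and> radicand k i \<rho> = 0)"

end

theory Submission
  imports Defs "HOL-Real_Asymp.Real_Asymp"
begin

text \<open>
  Put y = 1 / (2 x) and let s_i be the square root of the i-th radicand at x, divided by 2 x.  Then
  s_0 = y and s_i^2 = s_{i-1} + (i - 1) - c with c = k - y^2 + y.  If the (j+1)-st radicand vanishes,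
  this recursion can be run backwards from s_{j+1} = 0; with c = j + t it produces
  s_j = t, s_{j-1} = t^2 + t + 1, ..., and y = s_0, which is u_j for t = 0 and u_{j+1} for t = 1.
  Hence k = c + y^2 - y increases from N_j to N_{j+1} as t runs through [0,1], and the intermediate
  value theorem gives the t belonging to k.  The further radicands are positive there because t < 1,
  and all radicands increase with y, so that x is the first zero.

  The inequality |1 - sqrt (1 - w)| \<le> 1 - sqrt (1 - |w|) transports this to the complex disc:
  |1 - R_i z| \<le> 1 - R_i |z|, and the equality case excludes zeros of R_i, i \<ge> 2, at other points of
  the circle.  Only R_1 can vanish elsewhere, at -1/2 for k = 1, where the type is 1/2.
  Near the singularity, a simple zero of a radicand gives type 1/2, a radicand A + 2 z sqrt R with
  A and R both vanishing gives type 1/4, and the later square roots, taken at positive values,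
  preserve the type.
\<close>

section \<open>Generating functions of terms\<close>

text \<open>Scaling by 2 x makes the backward run possible: after division by 4 x^2 the abscissa
  enters the recursion of the s_i only through y^2 - y, so apart from the start value y both k and x
  collapse into the constant c. Monotonicity in y is available because y \<ge> 1 at the critical
  point, which comes from j \<ge> 1 and thus from k \<ge> 1. The principal square root is the main
  obstacle. On the closed disc a radicand meets the branch cut only at a zero, by the majorization.
  Beyond the disc there is no such bound, so near a vanishing radicand the continuation is assembled
  from factors with positive real part, on which the square root is multiplicative. Dominance
  compares the types at all singular points, so the type must be determined by the series. It is,
  because along the radius a function analytic at \<rho> vanishes or behaves like a constant times
  x^n with n a natural number, whereas types are not natural numbers.\<close>

definition terms :: "nat \<Rightarrow> nat \<Rightarrow> nat \<Rightarrow> lterm set" where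
  "terms m h n = {t. closed_under m t \<and> unary_height t \<le> h \<and> node_count t = n}"

text \<open>Removing a unary root trades one unit of the height h for one more admissible index m.
  Hence m + h stays constant, and the recursion for \<open>H_le k\<close> meets only the pairs (k -
  i, i).\<close>

definition terms_gf :: "nat \<Rightarrow> nat \<Rightarrow> complex fps" where
  "terms_gf m h = Abs_fps (\<lambda>n. of_nat (card (terms m h n)))"

lemma H_le_eq_terms_gf: "H_le k = terms_gf 0 k"
  by (simp add: H_le_def terms_gf_def terms_def)

lemma node_count_pos: "node_count t > 0"
  by (cases t) auto

lemma terms_0 [simp]: "terms m h 0 = {}"
  using node_count_pos by (auto simp: terms_def)

lemma terms_Suc:
  "terms m h (Suc n) =
     (if n = 0 then Var ` {..<m} else {}) \<union>
     (case h of 0 \<Rightarrow> {} | Suc h' \<Rightarrow> Lam ` terms (Suc m) h' n) \<union>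
     (\<Union>i\<le>n. (\<lambda>(s, t). App s t) ` (terms m h i \<times> terms m h (n - i)))"
proof (intro equalityI subsetI)
  fix t assume t: "t \<in> terms m h (Suc n)"
  show "t \<in> (if n = 0 then Var ` {..<m} else {}) \<union>
     (case h of 0 \<Rightarrow> {} | Suc h' \<Rightarrow> Lam ` terms (Suc m) h' n) \<union>
     (\<Union>i\<le>n. (\<lambda>(s, t). App s t) ` (terms m h i \<times> terms m h (n - i)))"
  proof (cases t)
    case (App a b)
    hence "(a, b) \<in> terms m h (node_count a) \<times> terms m h (n - node_count a)" "node_count a \<le> n"
      using t by (auto simp: terms_def)
    hence "App a b \<in> (\<Union>i\<le>n. (\<lambda>(s, t). App s t) ` (terms m h i \<times> terms m h (n - i)))"
      by force
    thus ?thesis using App by blast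
  qed (use t in \<open>auto simp: terms_def split: nat.split\<close>)
next
  fix t assume "t \<in> (if n = 0 then Var ` {..<m} else {}) \<union>
     (case h of 0 \<Rightarrow> {} | Suc h' \<Rightarrow> Lam ` terms (Suc m) h' n) \<union>
     (\<Union>i\<le>n. (\<lambda>(s, t). App s t) ` (terms m h i \<times> terms m h (n - i)))"
  thus "t \<in> terms m h (Suc n)"
    by (auto simp: terms_def split: if_splits nat.splits)
qed

lemma finite_terms: "finite (terms m h n)"
proof (induction n arbitrary: m h rule: less_induct)
  case (less n)
  show ?case
  proof (cases n)
    case (Suc l)
    have "finite (terms m h i \<times> terms m h (l - i))" if "i \<le> l" for i
      using less that Suc by (intro finite_cartesian_product) auto
    thus ?thesis
      using less Suc unfolding Suc terms_Suc
      by (intro finite_UnI finite_UN_I) (auto split: nat.split)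
  qed auto
qed

lemma card_terms_Suc:
  "card (terms m h (Suc n)) =
     (if n = 0 then m else 0) + (case h of 0 \<Rightarrow> 0 | Suc h' \<Rightarrow> card (terms (Suc m) h' n)) +
     (\<Sum>i\<le>n. card (terms m h i) * card (terms m h (n - i)))"
proof -
  let ?V = "if n = 0 then Var ` {..<m} else {}"
  let ?L = "case h of 0 \<Rightarrow> {} | Suc h' \<Rightarrow> Lam ` terms (Suc m) h' n"
  let ?A = "\<lambda>i. (\<lambda>(s, t). App s t) ` (terms m h i \<times> terms m h (n - i))"
  have finA: "finite (?A i)" for i by (simp add: finite_terms)
  \<comment> \<open>The sets are disjoint because i is the node count of the left subterm.\<close>
  have "card (\<Union>i\<le>n. ?A i) = (\<Sum>i\<le>n. card (?A i))"
    by (rule card_UN_disjoint) (auto simp: finite_terms, auto simp: terms_def)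
  also have "\<dots> = (\<Sum>i\<le>n. card (terms m h i) * card (terms m h (n - i)))"
    by (intro sum.cong refl, subst card_image) (auto simp: inj_on_def card_cartesian_product)
  finally have A: "card (\<Union>i\<le>n. ?A i) = \<dots>" .
  have L: "card ?L = (case h of 0 \<Rightarrow> 0 | Suc h' \<Rightarrow> card (terms (Suc m) h' n))"
    by (auto split: nat.split simp: card_image inj_on_def)
  have V: "card ?V = (if n = 0 then m else 0)"
    by (auto simp: card_image inj_on_def)
  have "card (terms m h (Suc n)) = card (?V \<union> ?L) + card (\<Union>i\<le>n. ?A i)"
    unfolding terms_Suc
    by (rule card_Un_disjoint) (auto simp: finite_terms split: nat.splits if_splits)
  also have "card (?V \<union> ?L) = card ?V + card ?L"
    by (rule card_Un_disjoint) (auto simp: finite_terms split: nat.splits if_splits)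
  finally show ?thesis by (simp only: A L V)
qed

lemma terms_gf_rec:
  "terms_gf m h = of_nat m * fps_X +
     (case h of 0 \<Rightarrow> 0 | Suc h' \<Rightarrow> fps_X * terms_gf (Suc m) h') + fps_X * (terms_gf m h)\<^sup>2"
proof (rule fps_ext)
  fix n
  show "terms_gf m h $ n = (of_nat m * fps_X +
     (case h of 0 \<Rightarrow> 0 | Suc h' \<Rightarrow> fps_X * terms_gf (Suc m) h') + fps_X * (terms_gf m h)\<^sup>2) $ n"
  proof (cases n)
    case 0
    thus ?thesis by (auto simp: terms_gf_def fps_of_nat[symmetric] simp del: fps_of_nat split: nat.split)
  next
    case (Suc l)
    have "terms_gf m h $ n = (of_nat (card (terms m h (Suc l))) :: complex)"
      by (simp add: terms_gf_def Suc)
    also have "\<dots> = (if l = 0 then of_nat m else 0) +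
        (case h of 0 \<Rightarrow> 0 | Suc h' \<Rightarrow> fps_X * terms_gf (Suc m) h') $ Suc l +
        (\<Sum>i\<le>l. terms_gf m h $ i * terms_gf m h $ (l - i))"
      by (auto simp: card_terms_Suc terms_gf_def split: nat.split)
    also have "(\<Sum>i\<le>l. terms_gf m h $ i * terms_gf m h $ (l - i)) = (terms_gf m h)\<^sup>2 $ l"
      by (simp add: power2_eq_square fps_mult_nth atLeast0AtMost)
    also have "(if l = 0 then of_nat m else 0) = (of_nat m * fps_X :: complex fps) $ n"
      by (simp add: Suc fps_of_nat[symmetric] del: fps_of_nat)
    finally show ?thesis by (simp add: Suc)
  qed
qed

text \<open>Subtracting the equations leaves (P - Q) (1 - X (P + Q)) = 0, and the second factor has
  constant coefficient 1. This selects the branch: the other root of the quadratic equation has a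
  pole at 0 and is no power series.\<close>

lemma fps_quadratic_unique:
  fixes P Q B :: "complex fps"
  assumes "P = B + fps_X * P\<^sup>2" "Q = B + fps_X * Q\<^sup>2"
  shows "P = Q"
proof -
  have "P - Q = fps_X * (P\<^sup>2 - Q\<^sup>2)"
    using arg_cong2[OF assms, of "(-)"] by (simp add: algebra_simps)
  hence "(P - Q) * (1 - fps_X * (P + Q)) = 0"
    by (simp add: algebra_simps power2_eq_square)
  moreover have "(1 - fps_X * (P + Q)) $ 0 = 1" by simp
  hence "1 - fps_X * (P + Q) \<noteq> 0" by force
  ultimately show ?thesis by simp
qed

section \<open>The first real zero\<close>

(* s_i^2 in the notation of the header. *)
fun scaled_radicand :: "nat \<Rightarrow> real \<Rightarrow> nat \<Rightarrow> real" where
  "scaled_radicand k y 0 = y\<^sup>2"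
| "scaled_radicand k y (Suc i) = y\<^sup>2 - y - real k + real i + sqrt (scaled_radicand k y i)"

lemma radicand_of_real:
  assumes "x > 0" "\<And>l. l \<le> i \<Longrightarrow> scaled_radicand k (1 / (2 * x)) l \<ge> 0"
  shows "radicand k (Suc i) (of_real x) = of_real (4 * x\<^sup>2 * scaled_radicand k (1 / (2 * x)) (Suc i))"
  using assms(2)
proof (induction i)
  case 0
  \<comment> \<open>The artificial start value y^2 has the root y, which cancels the summand -y; so
    one rule also covers the first radicand, which contains no square root.\<close>
  have "sqrt (scaled_radicand k (1 / (2 * x)) 0) = 1 / (2 * x)"
    unfolding scaled_radicand.simps real_sqrt_abs using assms(1) by simp
  hence "4 * x\<^sup>2 * scaled_radicand k (1 / (2 * x)) (Suc 0) = 1 - 4 * k * x\<^sup>2"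
    using assms(1) by (simp add: field_simps power2_eq_square)
  thus ?case by simp
next
  case (Suc i)
  define y where "y = 1 / (2 * x)"
  have xy: "2 * x * y = 1" using assms(1) by (simp add: y_def)
  have IH: "radicand k (Suc i) (of_real x) = of_real (4 * x\<^sup>2 * scaled_radicand k y (Suc i))"
    using Suc by (simp add: y_def)
  have nn: "scaled_radicand k y (Suc i) \<ge> 0" using Suc.prems[of "Suc i"] by (simp add: y_def)
  have "csqrt (radicand k (Suc i) (of_real x)) = of_real (sqrt ((2 * x)\<^sup>2 * scaled_radicand k y (Suc i)))"
    unfolding IH using nn by (subst csqrt_of_real) (auto simp: power_mult_distrib)
  also have "sqrt ((2 * x)\<^sup>2 * scaled_radicand k y (Suc i)) = 2 * x * sqrt (scaled_radicand k y (Suc i))"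
    using assms(1) by (simp add: real_sqrt_mult)
  finally have "radicand k (Suc (Suc i)) (of_real x) =
    of_real (1 - 4 * (real k - real (Suc (Suc i)) + 1) * x\<^sup>2 - 2 * x + 2 * x * (2 * x * sqrt (scaled_radicand k y (Suc i))))"
    by simp
  \<comment> \<open>Factors 2 x y = 1 are inserted until every term is a multiple of x^2.\<close>
  also have "1 - 4 * (real k - real (Suc (Suc i)) + 1) * x\<^sup>2 - 2 * x + 2 * x * (2 * x * sqrt (scaled_radicand k y (Suc i)))
     = (2*x*y)\<^sup>2 - 4 * (real k - real (Suc (Suc i)) + 1) * x\<^sup>2 - 2 * x * (2*x*y) + 2 * x * (2 * x * sqrt (scaled_radicand k y (Suc i)))"
    by (simp add: xy)
  also have "\<dots> = 4 * x\<^sup>2 * scaled_radicand k y (Suc (Suc i))"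
    by (simp add: algebra_simps power2_eq_square)
  finally show ?case by (simp add: y_def)
qed

text \<open>On [1, \<infinity>) the function y^2 - y increases, and so does the square root. As x =
  1 / (2 y), nonnegativity at the critical point turns into positivity at all smaller positive
  x.\<close>

lemma scaled_radicand_mono:
  assumes "1 \<le> y" "y < y'" "\<And>l. scaled_radicand k y l \<ge> 0"
  shows "scaled_radicand k y' i > scaled_radicand k y i"
proof (induction i)
  case 0
  show ?case using assms by (simp add: power_strict_mono)
next
  case (Suc i)
  have "(y' - y) * (y' + y - 1) > 0" using assms by (intro mult_pos_pos) auto
  moreover have "sqrt (scaled_radicand k y' i) \<ge> sqrt (scaled_radicand k y i)" using Suc by simp
  ultimately have "y\<^sup>2 - y + sqrt (scaled_radicand k y i) < y'\<^sup>2 - y' + sqrt (scaled_radicand k y' i)"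
    by (simp add: algebra_simps power2_eq_square del: real_sqrt_le_iff)
  thus ?case by simp
qed

(* backward t n is s_{j+1-n} in the notation of the header, for c = j + t. *)
fun backward :: "real \<Rightarrow> nat \<Rightarrow> real" where
  "backward t 0 = 0"
| "backward t (Suc n) = (backward t n)\<^sup>2 + t + real n"

text \<open>At t = 0 the values at the indices 0 and 1 are both 0, which is the double vanishing for
  k = N_j; from there on the recursion is that of u, delayed by one step. At t = 1 there is no
  delay.\<close>

lemma backward_0: "backward 0 (Suc n) = real (u_seq n)"
  by (induction n) auto

lemma backward_1: "backward 1 n = real (u_seq n)"
  by (induction n) auto

lemma continuous_on_backward [continuous_intros]: "continuous_on A (\<lambda>t. backward t n)"
  by (induction n) (auto intro!: continuous_intros)

lemma backward_ge_1: "t \<ge> 0 \<Longrightarrow> backward t (Suc (Suc n)) \<ge> 1"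
  by simp

lemma backward_nonneg: "t \<ge> 0 \<Longrightarrow> backward t n \<ge> 0"
  by (cases n) auto

lemma real_N_seq: "real (N_seq j) = (real (u_seq j))\<^sup>2 - real (u_seq j) + real j"
proof -
  have "u_seq j \<le> (u_seq j)\<^sup>2" by (simp add: power2_nat_le_imp_le)
  thus ?thesis unfolding N_seq_def by (simp add: of_nat_diff)
qed

text \<open>The intermediate value theorem does not say which t it finds. So for k = N_j the witness
  0 is given directly, and otherwise both ends are excluded because they would produce N_j or
  N_{j+1}.\<close>

lemma exists_parameter:
  assumes "k \<in> {N_seq j..<N_seq (j + 1)}"
  obtains t where "0 \<le> t" "t < 1" "t = 0 \<longleftrightarrow> k = N_seq j"
    "real k = real j + t + (backward t (Suc j))\<^sup>2 - backward t (Suc j)"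
proof (cases "k = N_seq j")
  case True
  show ?thesis
    by (rule that[of 0]) (use True real_N_seq[of j] in \<open>auto simp: backward_0 simp del: backward.simps\<close>)
next
  case False
  define K where "K t = real j + t + (backward t (Suc j))\<^sup>2 - backward t (Suc j)" for t
  have K0: "K 0 = real (N_seq j)" by (simp add: K_def real_N_seq backward_0 del: backward.simps)
  have K1: "K 1 = real (N_seq (Suc j))"
    unfolding K_def backward_1 real_N_seq by simp
  have "\<exists>t. 0 \<le> t \<and> t \<le> 1 \<and> K t = real k"
    using assms K0 K1 by (intro IVT') (auto simp: K_def intro!: continuous_intros simp del: backward.simps)
  then obtain t where t: "0 \<le> t" "t \<le> 1" "K t = real k" by blast
  moreover have "t \<noteq> 0" "t \<noteq> 1" using t(3) K0 K1 assms False by auto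
  ultimately show ?thesis using that[of t] False by (simp add: K_def)
qed

text \<open>The forward recursion undoes the backward one: the root of a squared backward value is
  that value, since it is nonnegative, and subtracting t + n leaves the square of its
  predecessor.\<close>

lemma scaled_radicand_eq_backward:
  assumes "0 \<le> t" "real k = real j + t + (backward t (Suc j))\<^sup>2 - backward t (Suc j)" "i \<le> Suc j"
  shows "scaled_radicand k (backward t (Suc j)) i = (backward t (Suc j - i))\<^sup>2"
  using assms(3)
proof (induction i)
  case (Suc i)
  have eq: "Suc j - i = Suc (j - i)" using Suc.prems by simp
  have "sqrt (scaled_radicand k (backward t (Suc j)) i) = (backward t (j - i))\<^sup>2 + t + real (j - i)"
    using Suc backward_nonneg[OF assms(1), of "Suc j - i"] by (simp add: eq del: backward.simps) simp
  thus ?case using Suc.prems assms(2) by (simp add: of_nat_diff)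
qed simp

lemma scaled_radicand_first_zero:
  assumes "k \<ge> 1" "k \<in> {N_seq j..<N_seq (j + 1)}"
  obtains y where "y \<ge> 1" "\<And>i. scaled_radicand k y i \<ge> 0"
    "\<And>i. scaled_radicand k y i = 0 \<longleftrightarrow> i = j + 1 \<or> i = j \<and> k = N_seq j"
    "k = N_seq j \<Longrightarrow> y = real (u_seq j)"
proof -
  have "j \<noteq> 0" using assms by (auto simp: N_seq_def intro!: Nat.gr0I)
  obtain t where t: "0 \<le> t" "t < 1" "t = 0 \<longleftrightarrow> k = N_seq j"
    "real k = real j + t + (backward t (Suc j))\<^sup>2 - backward t (Suc j)"
    using exists_parameter[OF assms(2)] by blast
  define y where "y = backward t (Suc j)"
  \<comment> \<open>By j \<ge> 1 the index \<open>Suc j\<close> is at least 2, where backward values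
    are at least 1.\<close>
  have y1: "y \<ge> 1" using backward_ge_1[of t "j - 1"] t(1) \<open>j \<noteq> 0\<close> by (simp add: y_def)
  have upto: "scaled_radicand k y i = (backward t (Suc j - i))\<^sup>2" if "i \<le> Suc j" for i
    using scaled_radicand_eq_backward[OF t(1,4) that] by (simp add: y_def)
  have step: "scaled_radicand k y (Suc i) = real i - real j - t + sqrt (scaled_radicand k y i)" for i
    using t(4) by (simp add: y_def del: backward.simps)
  \<comment> \<open>Just behind the zero the value is 1 - t > 0; n + 1 places later the summand
    outside the root is n + 2 - t > 0.\<close>
  have after: "scaled_radicand k y (Suc (Suc j) + n) > 0" for n
  proof (induction n)
    case 0
    show ?case using step[of "Suc j"] upto[of "Suc j"] t by simp
  next
    case (Suc n)
    show ?case using step[of "Suc (Suc j) + n"] real_sqrt_gt_zero[OF Suc] t(2)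
      by (simp del: scaled_radicand.simps real_sqrt_gt_0_iff)
  qed
  have cases: "i \<le> Suc j \<or> (\<exists>n. i = Suc (Suc j) + n)" for i
    using le_Suc_ex by (metis not_less_eq_eq)
  show ?thesis
  proof (rule that[of y])
    show "y \<ge> 1" by fact
    show "scaled_radicand k y i \<ge> 0" for i
      using cases[of i]
    proof
      assume "\<exists>n. i = Suc (Suc j) + n"
      then obtain n where "i = Suc (Suc j) + n" ..
      thus ?thesis using less_imp_le[OF after[of n]] by simp
    qed (simp only: upto zero_le_power2)
    show "y = real (u_seq j)" if "k = N_seq j"
      using that t(3) by (simp add: y_def backward_0 del: backward.simps)
    show "scaled_radicand k y i = 0 \<longleftrightarrow> i = j + 1 \<or> i = j \<and> k = N_seq j" for i
    proof (cases "i \<le> Suc j")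
      case True
      \<comment> \<open>The backward index is 0 (value 0), 1 (value t, zero exactly for k = N_j) or
        at least 2 (value at least 1).\<close>
      consider "i = Suc j" | "i = j" | n where "Suc j - i = Suc (Suc n)"
      proof (cases "i \<ge> j")
        case False
        thus ?thesis using that(3)[of "j - 1 - i"] by simp
      qed (use True that in fastforce)
      thus ?thesis
      proof cases
        case 3
        hence "scaled_radicand k y i \<noteq> 0" "i < j"
          using upto[OF True] backward_ge_1[OF t(1), of n] by (auto simp del: backward.simps)
        thus ?thesis by simp
      qed (use upto[OF True] t(3) in auto)
    next
      case False
      then obtain n where "i = Suc (Suc j) + n" using cases[of i] by blast
      thus ?thesis using after[of n] by simp
    qed
  qed
qed

declare scaled_radicand.simps(2) [simp del]

section \<open>Radicands on the complex disc\<close>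

text \<open>This reflects that 1 - sqrt (1 - w) has nonnegative Taylor coefficients, but no series
  is used. With s = csqrt (1 - w), a = |1 - s| and b = |1 + s| one has a b = |w| and a + b \<ge> 2,
  so a (2 - a) \<le> |w|, that is 1 - |w| \<le> (1 - a)^2; and a \<le> 1 permits taking
  roots.\<close>

lemma norm_one_minus_csqrt_le:
  assumes "norm w \<le> 1"
  shows "norm (1 - csqrt (1 - w)) \<le> 1 - sqrt (1 - norm w)"
proof -
  define s where "s = csqrt (1 - w)"
  define a where "a = norm (1 - s)"
  define b where "b = norm (1 + s)"
  have s2: "s\<^sup>2 = 1 - w" by (simp add: s_def)
  have "w = (1 - s) * (1 + s)" using s2 by (simp add: algebra_simps power2_eq_square)
  hence ab: "norm w = a * b" by (simp add: a_def b_def norm_mult)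
  have sum: "a + b \<ge> 2" using norm_triangle_ineq[of "1 - s" "1 + s"] by (simp add: a_def b_def)
  \<comment> \<open>The difference of the squares is 4 Re s, and the principal root has Re s \<ge>
    0.\<close>
  have "a\<^sup>2 \<le> b\<^sup>2"
    using Re_csqrt[of "1 - w"] unfolding a_def b_def cmod_power2
    by (simp add: s_def power2_eq_square algebra_simps)
  hence le: "a \<le> b" by (rule power2_le_imp_le) (simp add: b_def)
  have a0: "a \<ge> 0" by (simp add: a_def)
  have "a\<^sup>2 \<le> 1\<^sup>2" using mult_left_mono[OF le a0] ab assms by (simp add: power2_eq_square)
  hence "a \<le> 1" by (rule power2_le_imp_le) simp
  have "(1 - norm w) \<le> (1 - a)\<^sup>2"
    using mult_left_mono[OF sum a0] ab by (simp add: power2_eq_square algebra_simps)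
  hence "sqrt (1 - norm w) \<le> 1 - a"
    using \<open>a \<le> 1\<close> by (intro real_le_lsqrt) auto
  thus ?thesis by (simp add: a_def s_def)
qed

(* Equality forces |1 - s| + |1 + s| = 2 for s = csqrt (1 - w), so that s lies on the segment [-1,1]. *)
lemma norm_one_minus_csqrt_eq:
  assumes "norm w \<le> 1" "norm (1 - csqrt (1 - w)) = 1 - sqrt (1 - norm w)"
  shows "w = of_real (norm w)"
proof -
  define s where "s = csqrt (1 - w)"
  define a where "a = norm (1 - s)"
  define b where "b = norm (1 + s)"
  have s2: "s\<^sup>2 = 1 - w" by (simp add: s_def)
  have ws: "w = (1 - s) * (1 + s)" using s2 by (simp add: algebra_simps power2_eq_square)
  hence ab: "norm w = a * b" by (simp add: a_def b_def norm_mult)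
  have "1 - a = sqrt (1 - norm w)" using assms by (simp add: a_def s_def)
  hence "(1 - a)\<^sup>2 = 1 - a * b" using assms by (simp add: ab)
  hence eq: "a * (2 - a) = a * b" by (simp add: power2_eq_square algebra_simps)
  show ?thesis
  proof (cases "a = 0")
    case True
    thus ?thesis using ws by (simp add: a_def)
  next
    case False
    hence sum: "a + b = 2" using eq by simp
    hence "norm ((1 + s) + (1 - s)) = norm (1 + s) + norm (1 - s)"
      by (simp add: a_def b_def)
    hence "b *\<^sub>R (1 - s) = a *\<^sub>R (1 + s)"
      unfolding norm_triangle_eq a_def b_def .
    hence "complex_of_real (a + b) * s = of_real (b - a)"
      by (simp add: scaleR_conv_of_real algebra_simps)
    hence sab: "s = of_real ((b - a) / 2)" by (simp only: sum) (simp add: mult.commute)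
    have "w = of_real (1 - ((b - a) / 2)\<^sup>2)" using s2 unfolding sab by (simp add: algebra_simps)
    also have "1 - ((b - a) / 2)\<^sup>2 = ((a + b) / 2)\<^sup>2 - ((b - a) / 2)\<^sup>2" using sum by simp
    also have "\<dots> = a * b" by (simp add: power2_eq_square field_simps)
    finally show ?thesis using ab by simp
  qed
qed

lemma radicand_at_0 [simp]: "radicand k i 0 = 1"
  by (induction k i "0 :: complex" rule: radicand.induct) auto

lemma analytic_radicand:
  assumes "\<And>l. l < i \<Longrightarrow> radicand k (Suc l) z \<notin> \<real>\<^sub>\<le>\<^sub>0"
  shows "radicand k (Suc i) analytic_on {z}"
  using assms
proof (induction i)
  case 0
  have "(\<lambda>z. 1 - 4 * of_nat k * z\<^sup>2) analytic_on {z}" by (intro analytic_intros)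
  thus ?case by simp
next
  case (Suc i)
  have "(\<lambda>z. 1 - 4 * (of_nat k - of_nat (Suc (Suc i)) + 1) * z\<^sup>2 - 2 * z
       + 2 * z * csqrt (radicand k (Suc i) z)) analytic_on {z}"
    using Suc by (intro analytic_intros) auto
  thus ?case by (simp add: fun_eq_iff)
qed

declare radicand.simps(3) [simp del]

section \<open>Majorization of the radicands on a disc by their values on the positive
  radius\<close>

locale radicand_disc =
  fixes k :: nat and r :: real
  assumes k_pos: "k \<ge> 1" and r_pos: "r > 0"
    and nonneg: "\<And>i x. i \<le> k \<Longrightarrow> 0 \<le> x \<Longrightarrow> x \<le> r \<Longrightarrow> radicand k (Suc i) (of_real x) \<in> \<real>\<^sub>\<ge>\<^sub>0"
    and nonzero: "\<And>i x. i \<le> k \<Longrightarrow> 0 \<le> x \<Longrightarrow> x < r \<Longrightarrow> radicand k (Suc i) (of_real x) \<noteq> 0"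
begin

definition rval :: "nat \<Rightarrow> real \<Rightarrow> real" where
  "rval i x = Re (radicand k (Suc i) (of_real x))"

lemma
  assumes "i \<le> k" "0 \<le> x" "x \<le> r"
  shows radicand_eq_rval: "radicand k (Suc i) (of_real x) = of_real (rval i x)"
    and rval_nonneg: "rval i x \<ge> 0"
    and csqrt_radicand_of_real: "csqrt (radicand k (Suc i) (of_real x)) = of_real (sqrt (rval i x))"
proof -
  show 1: "radicand k (Suc i) (of_real x) = of_real (rval i x)" and 2: "rval i x \<ge> 0"
    using nonneg[OF assms] by (auto simp: rval_def complex_nonneg_Reals_iff complex_eq_iff)
  show "csqrt (radicand k (Suc i) (of_real x)) = of_real (sqrt (rval i x))"
    unfolding 1 using 2 by (rule csqrt_of_real)
qed

lemma rval_0: "rval 0 x = 1 - 4 * real k * x\<^sup>2"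
  by (simp add: rval_def flip: of_real_power)

lemma rval_Suc:
  assumes "i \<le> k" "0 \<le> x" "x \<le> r"
  shows "rval (Suc i) x = 1 - 4 * (real k - real (Suc (Suc i)) + 1) * x\<^sup>2 - 2 * x * (1 - sqrt (rval i x))"
  unfolding rval_def[of "Suc i"] radicand.simps csqrt_radicand_of_real[OF assms]
  by (simp add: algebra_simps flip: of_real_power)

lemma rval_less_1:
  assumes "i \<le> k" "0 < x" "x \<le> r"
  shows "rval i x < 1"
  using assms(1)
proof (induction i)
  case 0
  show ?case using assms k_pos by (simp add: rval_0)
next
  case (Suc i)
  hence "sqrt (rval i x) < 1" by simp
  hence "2 * x * (1 - sqrt (rval i x)) > 0" using assms by simp
  \<comment> \<open>The coefficient k - i - 1 is nonnegative exactly because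
    \<open>Suc i \<le> k\<close>; it is 0 for the outermost radicand.\<close>
  moreover have "4 * (real k - real (Suc (Suc i)) + 1) * x\<^sup>2 \<ge> 0"
    using Suc.prems by (intro mult_nonneg_nonneg) auto
  ultimately show ?case
    using rval_Suc[of i x] Suc.prems assms(2,3) by (simp only: Suc_leD less_imp_le)
qed

lemma radicand_Suc_Suc:
  "radicand k (Suc (Suc i)) z =
     1 - (of_real (4 * (real k - real (Suc (Suc i)) + 1)) * z\<^sup>2 + 2 * z * (1 - csqrt (radicand k (Suc i) z)))"
  by (simp add: radicand.simps algebra_simps)

text \<open>1 - R_{i+1} is a combination of z^2 and z (1 - csqrt R_i) with nonnegative coefficients,
  so absolute values may be taken term by term. The root inequality applies to w = 1 - R_i because
  the induction hypothesis gives |w| \<le> 1.\<close>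

lemma norm_one_minus_radicand_le:
  assumes "i \<le> k" "norm z \<le> r"
  shows "norm (1 - radicand k (Suc i) z) \<le> 1 - rval i (norm z)"
  using assms(1)
proof (induction i)
  case 0
  show ?case by (simp add: rval_0 norm_mult norm_power)
next
  case (Suc i)
  define w where "w = 1 - radicand k (Suc i) z"
  let ?m = "4 * (real k - real (Suc (Suc i)) + 1)"
  have m: "?m \<ge> 0" using Suc.prems by simp
  have w: "norm w \<le> 1 - rval i (norm z)" using Suc by (simp add: w_def)
  have nn: "rval i (norm z) \<ge> 0" using rval_nonneg[of i "norm z"] Suc.prems assms by simp
  have "norm (1 - csqrt (1 - w)) \<le> 1 - sqrt (1 - norm w)"
    using w nn by (intro norm_one_minus_csqrt_le) simp
  also have "\<dots> \<le> 1 - sqrt (rval i (norm z))" using w by simp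
  finally have *: "norm (1 - csqrt (radicand k (Suc i) z)) \<le> 1 - sqrt (rval i (norm z))"
    by (simp add: w_def)
  have "norm (1 - radicand k (Suc (Suc i)) z) = norm (of_real ?m * z\<^sup>2 + 2 * z * (1 - csqrt (radicand k (Suc i) z)))"
    unfolding radicand_Suc_Suc by simp
  also have "\<dots> \<le> norm (of_real ?m * z\<^sup>2) + norm (2 * z * (1 - csqrt (radicand k (Suc i) z)))"
    by (rule norm_triangle_ineq)
  also have "norm (of_real ?m * z\<^sup>2) = ?m * (norm z)\<^sup>2"
    using m by (simp only: norm_mult norm_power norm_of_real abs_of_nonneg)
  also have "norm (2 * z * (1 - csqrt (radicand k (Suc i) z))) \<le> 2 * norm z * (1 - sqrt (rval i (norm z)))"
    using * by (simp add: norm_mult mult_left_mono)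
  finally show ?case using rval_Suc[of i "norm z"] Suc.prems assms by simp
qed

text \<open>A real value x \<le> 0 would have |1 - x| = 1 - x \<ge> 1, while the majorization allows
  at most 1. So zeros are the only obstruction to analyticity of the square roots on the closed
  disc.\<close>

lemma radicand_nonpos_iff:
  assumes "i \<le> k" "norm z \<le> r"
  shows "radicand k (Suc i) z \<in> \<real>\<^sub>\<le>\<^sub>0 \<longleftrightarrow> radicand k (Suc i) z = 0"
proof
  assume "radicand k (Suc i) z \<in> \<real>\<^sub>\<le>\<^sub>0"
  then obtain x where x: "radicand k (Suc i) z = of_real x" "x \<le> 0"
    unfolding nonpos_Reals_def by blast
  have "norm (1 - radicand k (Suc i) z) = 1 - x"
    using x(2) norm_of_real[of "1 - x", where 'a = complex] by (simp add: x(1))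
  moreover have "rval i (norm z) \<ge> 0" using rval_nonneg[of i "norm z"] assms by simp
  ultimately have "x = 0" using norm_one_minus_radicand_le[OF assms] x(2) by linarith
  thus "radicand k (Suc i) z = 0" using x(1) by simp
qed (simp only: nonpos_Reals_zero_I)

lemma radicand_nonpos_disc:
  assumes "i \<le> k" "norm z < r"
  shows "radicand k (Suc i) z \<notin> \<real>\<^sub>\<le>\<^sub>0"
proof
  assume "radicand k (Suc i) z \<in> \<real>\<^sub>\<le>\<^sub>0"
  hence "radicand k (Suc i) z = 0" using radicand_nonpos_iff[of i z] assms by simp
  hence "rval i (norm z) = 0"
    using norm_one_minus_radicand_le[of i z] rval_nonneg[of i "norm z"] assms by simp
  thus False using nonzero[of i "norm z"] radicand_eq_rval[of i "norm z"] assms by simp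
qed

text \<open>At a zero two terms add up to 1, whereas their majorants add up to at most 1; hence
  equality holds in all estimates. The first radicand is exempt: it depends on z^2 only and cannot
  distinguish z from -z.\<close>

lemma radicand_zero_imp:
  assumes "i < k" "norm z \<le> r" "radicand k (Suc (Suc i)) z = 0"
  shows "z = of_real r"
proof -
  define x where "x = norm z"
  define w where "w = 1 - radicand k (Suc i) z"
  define p where "p = norm (1 - csqrt (1 - w))"
  define m where "m = 4 * (real k - real (Suc (Suc i)) + 1)"
  have m: "m \<ge> 0" using assms(1,2) by (simp add: m_def)
  have z0: "z \<noteq> 0" using assms(3) by auto
  hence x0: "x > 0" "x \<le> r" using assms(1,2) by (auto simp: x_def)
  have nn: "rval i x \<ge> 0" "rval (Suc i) x \<ge> 0"
    using rval_nonneg assms(1,2) x0 by auto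
  have w: "norm w \<le> 1 - rval i x"
    using norm_one_minus_radicand_le[of i z] assms(1,2) by (simp add: w_def x_def)
  have w1: "norm w \<le> 1" using w nn by simp
  have p1: "p \<le> 1 - sqrt (1 - norm w)" unfolding p_def by (rule norm_one_minus_csqrt_le[OF w1])
  have p2: "1 - sqrt (1 - norm w) \<le> 1 - sqrt (rval i x)" using w by simp
  have sum: "of_real m * z\<^sup>2 + 2 * z * (1 - csqrt (1 - w)) = 1"
    using assms(3) unfolding radicand_Suc_Suc w_def m_def by (simp add: algebra_simps)
  have nA: "norm (of_real m * z\<^sup>2) = m * x\<^sup>2"
    using m by (simp add: norm_mult norm_power x_def)
  have nB: "norm (2 * z * (1 - csqrt (1 - w))) = 2 * x * p" by (simp add: norm_mult x_def p_def)
  have "1 \<le> m * x\<^sup>2 + 2 * x * p"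
    using norm_triangle_ineq[of "of_real m * z\<^sup>2" "2 * z * (1 - csqrt (1 - w))"] nA nB sum by simp
  moreover have rS: "1 - rval (Suc i) x = m * x\<^sup>2 + 2 * x * (1 - sqrt (rval i x))"
    using rval_Suc[of i x] assms(1,2) x0 by (simp add: m_def)
  ultimately have "2 * x * (1 - sqrt (rval i x)) \<le> 2 * x * p" using nn by linarith
  hence "1 - sqrt (rval i x) \<le> p" using x0 by simp
  hence p3: "p = 1 - sqrt (rval i x)" and p4: "p = 1 - sqrt (1 - norm w)" using p1 p2 by linarith+
  have "rval i x < 1" using rval_less_1[of i x] assms(1,2) x0 by simp
  hence p_pos: "p > 0" using p3 by simp
  \<comment> \<open>Equality in the root inequality makes the factor 1 - csqrt (1 - w) the positive
    real number p.\<close>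
  have "w = of_real (norm w)" using norm_one_minus_csqrt_eq[OF w1] p4 by (simp add: p_def)
  hence "1 - w = of_real (1 - norm w)" by simp
  hence "csqrt (1 - w) = of_real (sqrt (1 - norm w))" using w1 by (simp only: csqrt_of_real)
  hence cp: "1 - csqrt (1 - w) = of_real p" using p4 by simp
  have eq: "m * x\<^sup>2 + 2 * x * p = 1" using rS nn \<open>1 \<le> m * x\<^sup>2 + 2 * x * p\<close> unfolding p3 by linarith
  \<comment> \<open>Comparing real parts, the linear term 2 p z must contribute its full modulus,
    which forces Re z = |z|.\<close>
  have "Re (of_real m * z\<^sup>2) \<le> m * x\<^sup>2" using complex_Re_le_cmod[of "of_real m * z\<^sup>2"] nA by simp
  moreover have "Re (of_real m * z\<^sup>2) + 2 * p * Re z = 1"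
    using arg_cong[OF sum, of Re] cp by (simp add: algebra_simps)
  ultimately have "2 * x * p \<le> 2 * p * Re z" using eq by linarith
  hence "Re z \<ge> x" using p_pos by simp
  hence "z = of_real x"
    using complex_Re_le_cmod[of z] cmod_power2[of z] by (simp add: x_def complex_eq_iff)
  moreover have "x = r"
  proof (rule ccontr)
    assume "x \<noteq> r"
    hence "radicand k (Suc (Suc i)) (of_real x) \<noteq> 0" using nonzero[of "Suc i" x] x0 assms by simp
    thus False using assms(3) \<open>z = of_real x\<close> by simp
  qed
  ultimately show ?thesis by simp
qed

(* Equals (1 - csqrt (radicand k (Suc i) z)) / (2 z), rationalized so that z = 0 is covered. *)
definition branch :: "nat \<Rightarrow> complex \<Rightarrow> complex" where
  "branch i z = (2 * of_nat (k - i) * z + (case i of 0 \<Rightarrow> 0 | Suc l \<Rightarrow> 1 - csqrt (radicand k (Suc l) z))) /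
     (1 + csqrt (radicand k (Suc i) z))"

section \<open>Identification of the branches with the generating functions\<close>

lemma one_plus_csqrt_nonzero: "1 + csqrt z \<noteq> 0"
proof
  assume "1 + csqrt z = 0"
  hence "Re (1 + csqrt z) = 0" by (simp only: zero_complex.sel)
  thus False using Re_csqrt[of z] by (simp del: csqrt.simps)
qed

text \<open>Both sides are multiplied by 1 + q, with q the square root on the left; 1 - q^2 is 1
  minus the radicand and contains the factor 2 z. No division by z occurs, so z = 0 is
  included.\<close>

lemma one_minus_csqrt_radicand:
  assumes "i \<le> k"
  shows "1 - csqrt (radicand k (Suc i) z) = 2 * z * branch i z"
proof -
  define q where "q = csqrt (radicand k (Suc i) z)"
  have q2: "q\<^sup>2 = radicand k (Suc i) z" by (simp add: q_def)
  have q1: "1 + q \<noteq> 0" unfolding q_def by (rule one_plus_csqrt_nonzero)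
  have "(1 - q) * (1 + q) = 1 - radicand k (Suc i) z"
    by (simp flip: q2 add: algebra_simps power2_eq_square)
  also have "\<dots> = 2 * z * (2 * of_nat (k - i) * z + (case i of 0 \<Rightarrow> 0 | Suc l \<Rightarrow> 1 - csqrt (radicand k (Suc l) z)))"
    using assms by (cases i) (auto simp: radicand.simps power2_eq_square algebra_simps of_nat_diff)
  also have "\<dots> = 2 * z * branch i z * (1 + q)"
    using q1 by (simp add: branch_def q_def)
  finally show ?thesis using q1 by (simp add: q_def)
qed

text \<open>This is the equation of \<open>terms_gf_rec\<close> for m = k - i and h = i, read for
  functions.\<close>

lemma branch_rec:
  assumes "i \<le> k"
  shows "branch i z = of_nat (k - i) * z + (case i of 0 \<Rightarrow> 0 | Suc l \<Rightarrow> z * branch l z) + z * (branch i z)\<^sup>2"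
proof -
  define q where "q = csqrt (radicand k (Suc i) z)"
  have q: "q = 1 - 2 * z * branch i z" using one_minus_csqrt_radicand[OF assms, of z] by (simp add: q_def algebra_simps)
  have q1: "1 + q \<noteq> 0" unfolding q_def by (rule one_plus_csqrt_nonzero)
  have "branch i z * (1 + q) = 2 * of_nat (k - i) * z + (case i of 0 \<Rightarrow> 0 | Suc l \<Rightarrow> 1 - csqrt (radicand k (Suc l) z))"
    using q1 by (simp add: branch_def q_def)
  also have "(case i of 0 \<Rightarrow> 0 | Suc l \<Rightarrow> 1 - csqrt (radicand k (Suc l) z)) = 
      2 * (case i of 0 \<Rightarrow> 0 | Suc l \<Rightarrow> z * branch l z)"
    using assms one_minus_csqrt_radicand by (auto split: nat.split)
  finally have "2 * branch i z = 2 * (of_nat (k - i) * z + (case i of 0 \<Rightarrow> 0 | Suc l \<Rightarrow> z * branch l z) + z * (branch i z)\<^sup>2)"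
    unfolding q by (simp add: algebra_simps power2_eq_square)
  thus ?thesis by (subst (asm) mult_left_cancel) auto
qed

lemma analytic_branch:
  assumes "\<And>l. l \<le> i \<Longrightarrow> radicand k (Suc l) z \<notin> \<real>\<^sub>\<le>\<^sub>0"
  shows "branch i analytic_on {z}"
proof -
  have "radicand k (Suc l) analytic_on {z}" if "l \<le> i" for l
    using assms that by (intro analytic_radicand) auto
  hence *: "(\<lambda>z. csqrt (radicand k (Suc l) z)) analytic_on {z}" if "l \<le> i" for l
    using that assms by (intro analytic_intros) auto
  show ?thesis unfolding branch_def
    by (cases i) (auto intro!: analytic_intros * simp: one_plus_csqrt_nonzero simp del: radicand.simps)
qed

lemma holomorphic_branch: "i \<le> k \<Longrightarrow> branch i holomorphic_on ball 0 r"
  by (intro analytic_imp_holomorphic, subst analytic_on_analytic_at)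
     (use radicand_nonpos_disc in \<open>auto intro!: analytic_branch\<close>)

text \<open>The radicand with index i + 1 governs subterms below k - i unary nodes that may use i
  more. The Taylor series of the branch and the counting series solve the same quadratic equation,
  whose inhomogeneous part is known by induction.\<close>

lemma branch_has_fps_expansion:
  "i \<le> k \<Longrightarrow> branch i has_fps_expansion terms_gf (k - i) i"
proof (induction i)
  case 0
  let ?E = "fps_expansion (branch 0) 0"
  have E: "branch 0 has_fps_expansion ?E"
    using holomorphic_branch[OF 0] r_pos by (intro has_fps_expansion_fps_expansion[of "ball 0 r"]) auto
  have "(\<lambda>z. of_nat k * z + z * (branch 0 z)\<^sup>2) has_fps_expansion fps_const (of_nat k) * fps_X + fps_X * ?E\<^sup>2"
    by (intro fps_expansion_intros E)
  moreover have "(\<lambda>z. of_nat k * z + z * (branch 0 z)\<^sup>2) = branch 0"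
    by (rule ext, subst (2) branch_rec) auto
  ultimately have "?E = fps_const (of_nat k) * fps_X + fps_X * ?E\<^sup>2"
    by (intro fps_expansion_unique_complex[OF E]) (simp only:)
  moreover have "terms_gf k 0 = fps_const (of_nat k) * fps_X + fps_X * (terms_gf k 0)\<^sup>2"
    by (subst terms_gf_rec) (simp add: fps_of_nat)
  ultimately have "?E = terms_gf k 0" by (rule fps_quadratic_unique)
  thus ?case using E by simp
next
  case (Suc i)
  let ?E = "fps_expansion (branch (Suc i)) 0" and ?m = "k - Suc i"
  have E: "branch (Suc i) has_fps_expansion ?E"
    using holomorphic_branch[OF Suc.prems] r_pos by (intro has_fps_expansion_fps_expansion[of "ball 0 r"]) auto
  have m: "Suc ?m = k - i" using Suc.prems by simp
  have IH: "branch i has_fps_expansion terms_gf (Suc ?m) i" unfolding m using Suc by simp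
  have "(\<lambda>z. of_nat ?m * z + z * branch i z + z * (branch (Suc i) z)\<^sup>2) has_fps_expansion
     fps_const (of_nat ?m) * fps_X + fps_X * terms_gf (Suc ?m) i + fps_X * ?E\<^sup>2"
    by (intro fps_expansion_intros E IH)
  moreover have "(\<lambda>z. of_nat ?m * z + z * branch i z + z * (branch (Suc i) z)\<^sup>2) = branch (Suc i)"
    by (rule ext, subst (2) branch_rec[OF Suc.prems]) auto
  ultimately have "?E = fps_const (of_nat ?m) * fps_X + fps_X * terms_gf (Suc ?m) i + fps_X * ?E\<^sup>2"
    by (intro fps_expansion_unique_complex[OF E]) (simp only:)
  moreover have "terms_gf ?m (Suc i) = fps_const (of_nat ?m) * fps_X + fps_X * terms_gf (Suc ?m) i + fps_X * (terms_gf ?m (Suc i))\<^sup>2"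
    by (subst terms_gf_rec) (simp add: fps_of_nat)
  ultimately have "?E = terms_gf ?m (Suc i)" by (rule fps_quadratic_unique)
  thus ?case using E by simp
qed

lemma H_le_has_fps_expansion: "branch k has_fps_expansion H_le k"
  using branch_has_fps_expansion[of k] by (simp add: H_le_eq_terms_gf)

lemma fps_conv_radius_H_le: "fps_conv_radius (H_le k) \<ge> ereal r"
  by (rule holomorphic_on_imp_fps_conv_radius_ge[OF H_le_has_fps_expansion])
     (use holomorphic_branch in simp)

lemma eval_fps_H_le: "norm z < r \<Longrightarrow> eval_fps (H_le k) z = branch k z"
  by (rule has_fps_expansion_imp_eval_fps_eq[OF H_le_has_fps_expansion _ holomorphic_branch]) auto

end

section \<open>Uniqueness of the singularity type\<close>

text \<open>The map 1 - z / \<rho> carries the slit to the standard branch cut, so principal powers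
  and roots of 1 - z / \<rho> are analytic off the slit.\<close>

lemma slit_ray_iff:
  fixes \<rho> :: complex
  assumes "\<rho> \<noteq> 0"
  shows "z \<in> {of_real t * \<rho> |t. t \<ge> 1} \<longleftrightarrow> 1 - z / \<rho> \<in> \<real>\<^sub>\<le>\<^sub>0"
proof
  assume "1 - z / \<rho> \<in> \<real>\<^sub>\<le>\<^sub>0"
  then obtain x where "1 - z / \<rho> = of_real x" "x \<le> 0" unfolding nonpos_Reals_def by blast
  hence "z = of_real (1 - x) * \<rho> \<and> 1 - x \<ge> 1" using assms by (simp add: field_simps)
  thus "z \<in> {of_real t * \<rho> |t. t \<ge> 1}" by blast
next
  assume "z \<in> {of_real t * \<rho> |t. t \<ge> 1}"
  then obtain t where "z = of_real t * \<rho>" "t \<ge> 1" by blast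
  hence "1 - z / \<rho> = of_real (1 - t)" "1 - t \<le> 0" using assms by auto
  thus "1 - z / \<rho> \<in> \<real>\<^sub>\<le>\<^sub>0" by (simp only: nonpos_Reals_of_real_iff)
qed

lemma slit_domain_eq:
  assumes "\<rho> \<noteq> 0"
  shows "slit_domain \<rho> \<epsilon> = ball 0 (norm \<rho>) \<union> {z \<in> ball \<rho> \<epsilon>. 1 - z / \<rho> \<notin> \<real>\<^sub>\<le>\<^sub>0}"
  using slit_ray_iff[OF assms] unfolding slit_domain_def by blast

lemma Re_one_minus_pos:
  fixes \<rho> :: complex
  assumes "norm z < norm \<rho>"
  shows "Re (1 - z / \<rho>) > 0"
proof -
  have "norm (z / \<rho>) < 1"
    using assms by (metis norm_divide divide_less_eq_1_pos norm_ge_zero order.strict_trans1)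
  thus ?thesis using complex_Re_le_cmod[of "z / \<rho>"] by simp
qed

lemma slit_domain_subset:
  assumes "\<rho> \<noteq> 0"
  shows "slit_domain \<rho> \<epsilon> \<subseteq> {z. 1 - z / \<rho> \<notin> \<real>\<^sub>\<le>\<^sub>0}"
  using Re_one_minus_pos[of _ \<rho>] unfolding slit_domain_eq[OF assms]
  by (fastforce simp: complex_nonpos_Reals_iff)

lemma slit_domain_mono: "\<epsilon> \<le> \<epsilon>' \<Longrightarrow> slit_domain \<rho> \<epsilon> \<subseteq> slit_domain \<rho> \<epsilon>'"
  by (auto simp: slit_domain_def)

lemma open_slit:
  fixes \<rho> :: complex
  assumes "\<rho> \<noteq> 0"
  shows "open {z. 1 - z / \<rho> \<notin> \<real>\<^sub>\<le>\<^sub>0}"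
proof -
  have "open ((\<lambda>z. 1 - z / \<rho>) -` (- \<real>\<^sub>\<le>\<^sub>0))"
    by (rule open_vimage) (auto intro!: continuous_intros assms)
  thus ?thesis by (simp add: vimage_def)
qed

text \<open>The filter does not depend on \<epsilon>, so \<epsilon> can be decreased without
  touching limits already established.\<close>

lemma at_slit_domain:
  assumes "\<rho> \<noteq> 0" "\<epsilon> > 0"
  shows "at \<rho> within slit_domain \<rho> \<epsilon> = at \<rho> within {z. 1 - z / \<rho> \<notin> \<real>\<^sub>\<le>\<^sub>0}"
proof (rule at_within_nhd[of _ "ball \<rho> \<epsilon>"])
  show "slit_domain \<rho> \<epsilon> \<inter> ball \<rho> \<epsilon> - {\<rho>} = {z. 1 - z / \<rho> \<notin> \<real>\<^sub>\<le>\<^sub>0} \<inter> ball \<rho> \<epsilon> - {\<rho>}"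
    using slit_domain_subset[OF assms(1), of \<epsilon>] unfolding slit_domain_eq[OF assms(1)] by blast
qed (use assms in auto)

text \<open>Decreasing \<epsilon> shrinks only the part outside the disc; what is claimed inside the
  disc has to come from elsewhere.\<close>

lemma eventually_at_slit_domain:
  assumes "\<rho> \<noteq> 0" "\<epsilon> > 0" "eventually P (at \<rho> within slit_domain \<rho> \<epsilon>)"
  obtains \<epsilon>' where "0 < \<epsilon>'" "\<epsilon>' \<le> \<epsilon>" "\<And>z. z \<in> slit_domain \<rho> \<epsilon>' \<Longrightarrow> z \<notin> ball 0 (norm \<rho>) \<Longrightarrow> P z"
proof -
  obtain d where d: "d > 0" "\<forall>z\<in>slit_domain \<rho> \<epsilon>. z \<noteq> \<rho> \<and> dist z \<rho> < d \<longrightarrow> P z"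
    using assms(3) unfolding eventually_at by blast
  show ?thesis
  proof (rule that[of "min d \<epsilon>"])
    fix z assume z: "z \<in> slit_domain \<rho> (min d \<epsilon>)" "z \<notin> ball 0 (norm \<rho>)"
    have "z \<noteq> \<rho>" using z assms(1) by (auto simp: slit_domain_eq)
    moreover have "z \<in> slit_domain \<rho> \<epsilon>" using slit_domain_mono[of "min d \<epsilon>" \<epsilon> \<rho>] z by auto
    moreover have "dist z \<rho> < d" using z by (auto simp: slit_domain_def dist_commute)
    ultimately show "P z" using d by blast
  qed (use d assms in auto)
qed

text \<open>Near \<rho> the radius lies in the disc, where the continuation equals the series, and
  there 1 - z / \<rho> is the positive real x.\<close>

lemma filterlim_radial:
  assumes "\<rho> \<noteq> 0" "\<epsilon> > 0"
  shows "filterlim (\<lambda>x. \<rho> * (1 - of_real x)) (at \<rho> within slit_domain \<rho> \<epsilon>) (at_right 0)"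
  unfolding at_slit_domain[OF assms] filterlim_at
proof
  have "((\<lambda>x. \<rho> * (1 - of_real x)) \<longlongrightarrow> \<rho> * (1 - of_real 0)) (at_right 0)"
    by (intro tendsto_intros)
  thus "((\<lambda>x. \<rho> * (1 - of_real x)) \<longlongrightarrow> \<rho>) (at_right 0)" by simp
  show "\<forall>\<^sub>F x in at_right 0. \<rho> * (1 - complex_of_real x) \<in> {z. 1 - z / \<rho> \<notin> \<real>\<^sub>\<le>\<^sub>0} \<and> \<rho> * (1 - complex_of_real x) \<noteq> \<rho>"
    using eventually_at_right_less[of 0] by eventually_elim (use assms in auto)
qed

lemma powr_tendsto_imp_zero:
  assumes "((\<lambda>x. complex_of_real (x powr b)) \<longlongrightarrow> c) (at_right 0)" "c \<noteq> 0"
  shows "b = 0"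
proof (rule ccontr)
  assume "b \<noteq> 0"
  then consider "b > 0" | "b < 0" by linarith
  thus False
  proof cases
    case 1
    hence "((\<lambda>x::real. x powr b) \<longlongrightarrow> 0) (at_right 0)" by real_asymp
    hence "((\<lambda>x. complex_of_real (x powr b)) \<longlongrightarrow> of_real 0) (at_right 0)" by (intro tendsto_of_real)
    thus False using tendsto_unique[OF _ assms(1)] assms(2) by force
  next
    case 2
    hence "filterlim (\<lambda>x::real. x powr b) at_top (at_right 0)" by real_asymp
    moreover have "((\<lambda>x. norm (complex_of_real (x powr b))) \<longlongrightarrow> norm c) (at_right 0)"
      using assms(1) by (rule tendsto_norm)
    hence "((\<lambda>x. x powr b) \<longlongrightarrow> norm c) (at_right 0)" by simp
    ultimately show False using not_tendsto_and_filterlim_at_infinity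
      by (metis filterlim_at_top_imp_at_infinity trivial_limit_at_right_real)
  qed
qed

text \<open>If n is the order of the zero of h at \<rho>, then h behaves like a constant times x^n
  along the radius, and x^n / x^a has a finite nonzero limit only for a = n.\<close>

lemma analytic_radial_order:
  assumes "h analytic_on {\<rho>}" "\<rho> \<noteq> 0" "c \<noteq> 0"
    "((\<lambda>x. h (\<rho> * (1 - of_real x)) / of_real (x powr a)) \<longlongrightarrow> c) (at_right 0)"
  shows "a \<in> \<nat>"
proof -
  obtain F where F: "(\<lambda>x. h (\<rho> + x)) has_fps_expansion F"
    using analytic_at_imp_has_fps_expansion[OF assms(1)] by blast
  define n where "n = subdegree F"
  define C where "C = fps_nth F n * (- \<rho>) ^ n"
  have "(\<lambda>x. h (\<rho> + x)) \<sim>[nhds 0] (\<lambda>z. fps_nth F n * z ^ n)"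
    using has_fps_expansion_imp_asymp_equiv_0[OF F] by (simp add: n_def)
  moreover have "((\<lambda>x. - \<rho> * complex_of_real x) \<longlongrightarrow> - \<rho> * of_real 0) (at_right 0)"
    by (intro tendsto_intros)
  hence "filterlim (\<lambda>x. - \<rho> * complex_of_real x) (nhds 0) (at_right 0)" by simp
  ultimately have eq: "(\<lambda>x. h (\<rho> + - \<rho> * complex_of_real x)) \<sim>[at_right 0] (\<lambda>x. fps_nth F n * (- \<rho> * complex_of_real x) ^ n)"
    by (rule asymp_equiv_compose')
  have "\<rho> + - \<rho> * complex_of_real x = \<rho> * (1 - of_real x)" for x by (simp add: algebra_simps)
  moreover have "fps_nth F n * (- \<rho> * complex_of_real x) ^ n = C * of_real x ^ n" for x
    unfolding C_def power_mult_distrib by (simp only: mult.assoc)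
  ultimately have eq: "(\<lambda>x. h (\<rho> * (1 - of_real x))) \<sim>[at_right 0] (\<lambda>x. C * of_real x ^ n)"
    using eq by (simp only:)
  \<comment> \<open>C is 0 only for the zero expansion; then h vanishes near \<rho> on the radius,
    against the nonzero limit c.\<close>
  have C0: "C \<noteq> 0"
  proof
    assume "C = 0"
    hence "eventually (\<lambda>x. h (\<rho> * (1 - of_real x)) = 0) (at_right 0)"
      using asymp_equiv_eventually_zeros[OF eq] by simp
    hence "eventually (\<lambda>x. h (\<rho> * (1 - of_real x)) / of_real (x powr a) = 0) (at_right 0)"
      by eventually_elim simp
    hence "((\<lambda>x. h (\<rho> * (1 - of_real x)) / of_real (x powr a)) \<longlongrightarrow> 0) (at_right 0)"
      by (rule tendsto_eventually)
    thus False using tendsto_unique[OF _ assms(4)] assms(3) by force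
  qed
  have "((\<lambda>x. h (\<rho> * (1 - of_real x)) / (C * of_real x ^ n)) \<longlongrightarrow> 1) (at_right 0)"
  proof (rule asymp_equivD_strong[OF eq])
    show "\<forall>\<^sub>F x in at_right 0. h (\<rho> * (1 - complex_of_real x)) \<noteq> 0 \<or> C * complex_of_real x ^ n \<noteq> 0"
      using eventually_at_right_less[of 0] by eventually_elim (use C0 in auto)
  qed
  from tendsto_divide[OF assms(4) this]
  have "((\<lambda>x. (h (\<rho> * (1 - of_real x)) / of_real (x powr a)) / (h (\<rho> * (1 - of_real x)) / (C * of_real x ^ n))) \<longlongrightarrow> c) (at_right 0)"
    by simp
  moreover have "eventually (\<lambda>x. h (\<rho> * (1 - of_real x)) / of_real (x powr a) \<noteq> 0) (at_right 0)"
    using tendsto_imp_eventually_ne[OF assms(4,3)] .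
  hence "eventually (\<lambda>x. (h (\<rho> * (1 - of_real x)) / of_real (x powr a)) / (h (\<rho> * (1 - of_real x)) / (C * of_real x ^ n)) =
      C * of_real (x powr (real n - a))) (at_right 0)"
    using eventually_at_right_less[of 0]
  proof eventually_elim
    case (elim x)
    have "x powr (real n - a) = x ^ n / x powr a" using elim by (simp add: powr_diff powr_realpow)
    thus ?case using elim by simp
  qed
  ultimately have "((\<lambda>x. C * of_real (x powr (real n - a))) \<longlongrightarrow> c) (at_right 0)"
    by (rule Lim_transform_eventually)
  from tendsto_divide[OF this tendsto_const[of C]] C0
  have "((\<lambda>x. complex_of_real (x powr (real n - a))) \<longlongrightarrow> c / C) (at_right 0)" by simp
  hence "real n - a = 0" by (rule powr_tendsto_imp_zero) (use C0 assms(3) in simp)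
  hence "a = real n" by simp
  thus ?thesis by simp
qed

lemma eventually_norm_radial_less:
  assumes "\<rho> \<noteq> (0 :: complex)"
  shows "\<forall>\<^sub>F x in at_right 0. norm (\<rho> * (1 - of_real x)) < norm \<rho>"
proof -
  have "\<forall>\<^sub>F x in at_right (0::real). x \<in> {0<..<1}" by (rule eventually_at_right_real) simp
  thus ?thesis
  proof eventually_elim
    case (elim x)
    have "norm (1 - complex_of_real x) = \<bar>1 - x\<bar>" by (metis norm_of_real of_real_1 of_real_diff)
    thus ?case using elim assms by (simp add: norm_mult)
  qed
qed

text \<open>This eliminates the continuation f, so that two representations of one series become
  comparable.\<close>

lemma has_singularity_type_radial:
  assumes "has_singularity_type F \<rho> \<alpha>"
  obtains g c where "g analytic_on {\<rho>}" "c \<noteq> 0"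
    "((\<lambda>x. (eval_fps F (\<rho> * (1 - of_real x)) - g (\<rho> * (1 - of_real x))) / of_real (x powr \<alpha>)) \<longlongrightarrow> c) (at_right 0)"
proof -
  obtain \<epsilon> f g c where \<rho>: "\<rho> \<noteq> 0" and \<epsilon>: "\<epsilon> > 0" and f: "\<forall>z\<in>ball 0 (norm \<rho>). f z = eval_fps F z"
    and g: "g analytic_on {\<rho>}" and c: "c \<noteq> 0"
    and eq: "(\<lambda>z. f z - g z) \<sim>[at \<rho> within slit_domain \<rho> \<epsilon>] (\<lambda>z. c * (1 - z / \<rho>) powr of_real \<alpha>)"
    using assms unfolding has_singularity_type_def by blast
  have "(\<lambda>x. f (\<rho> * (1 - of_real x)) - g (\<rho> * (1 - of_real x))) \<sim>[at_right 0]
      (\<lambda>x. c * (1 - (\<rho> * (1 - of_real x)) / \<rho>) powr of_real \<alpha>)"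
    by (rule asymp_equiv_compose'[OF eq filterlim_radial[OF \<rho> \<epsilon>]])
  also have "(\<lambda>x. c * (1 - (\<rho> * (1 - complex_of_real x)) / \<rho>) powr of_real \<alpha>) = (\<lambda>x. c * of_real x powr of_real \<alpha>)"
    using \<rho> by simp
  finally have "((\<lambda>x. (f (\<rho> * (1 - of_real x)) - g (\<rho> * (1 - of_real x))) / (c * of_real x powr of_real \<alpha>)) \<longlongrightarrow> 1) (at_right 0)"
  proof (rule asymp_equivD_strong)
    show "\<forall>\<^sub>F x in at_right 0. f (\<rho> * (1 - complex_of_real x)) - g (\<rho> * (1 - complex_of_real x)) \<noteq> 0 \<or>
       c * complex_of_real x powr complex_of_real \<alpha> \<noteq> 0"
      using eventually_at_right_less[of 0] by eventually_elim (use c in auto)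
  qed
  from tendsto_mult[OF tendsto_const[of c] this]
  have "((\<lambda>x. c * ((f (\<rho> * (1 - of_real x)) - g (\<rho> * (1 - of_real x))) / (c * of_real x powr of_real \<alpha>))) \<longlongrightarrow> c) (at_right 0)"
    by simp
  also have "?this \<longleftrightarrow> ((\<lambda>x. (eval_fps F (\<rho> * (1 - of_real x)) - g (\<rho> * (1 - of_real x))) / of_real (x powr \<alpha>)) \<longlongrightarrow> c) (at_right 0)"
  proof (rule tendsto_cong)
    show "\<forall>\<^sub>F x in at_right 0. c * ((f (\<rho> * (1 - of_real x)) - g (\<rho> * (1 - of_real x))) / (c * of_real x powr of_real \<alpha>)) =
      (eval_fps F (\<rho> * (1 - of_real x)) - g (\<rho> * (1 - of_real x))) / of_real (x powr \<alpha>)"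
      using eventually_norm_radial_less[OF \<rho>] eventually_at_right_less[of 0]
      by eventually_elim (use c f in \<open>simp add: powr_of_real\<close>)
  qed
  finally show ?thesis using that g c by blast
qed

lemma has_singularity_type_not_analytic:
  assumes "has_singularity_type F \<rho> \<alpha>" "p analytic_on {\<rho>}"
    "\<And>z. norm z < norm \<rho> \<Longrightarrow> eval_fps F z = p z"
  shows False
proof -
  have \<rho>: "\<rho> \<noteq> 0" and \<alpha>: "\<alpha> \<notin> \<nat>" using assms(1) by (auto simp: has_singularity_type_def)
  obtain g c where g: "g analytic_on {\<rho>}" and c: "c \<noteq> 0" and
    lim: "((\<lambda>x. (eval_fps F (\<rho> * (1 - of_real x)) - g (\<rho> * (1 - of_real x))) / of_real (x powr \<alpha>)) \<longlongrightarrow> c) (at_right 0)"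
    using has_singularity_type_radial[OF assms(1)] .
  have "((\<lambda>x. (p (\<rho> * (1 - of_real x)) - g (\<rho> * (1 - of_real x))) / of_real (x powr \<alpha>)) \<longlongrightarrow> c) (at_right 0)"
  proof (rule Lim_transform_eventually[OF lim])
    show "\<forall>\<^sub>F x in at_right 0. (eval_fps F (\<rho> * (1 - of_real x)) - g (\<rho> * (1 - of_real x))) / of_real (x powr \<alpha>) =
       (p (\<rho> * (1 - of_real x)) - g (\<rho> * (1 - of_real x))) / of_real (x powr \<alpha>)"
      using eventually_norm_radial_less[OF \<rho>] by eventually_elim (simp add: assms(3))
  qed
  hence "\<alpha> \<in> \<nat>"
    by (intro analytic_radial_order[of "\<lambda>z. p z - g z" \<rho> c] analytic_on_diff assms g \<rho> c)
  with \<alpha> show False ..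
qed

text \<open>If \<beta> > \<alpha>, the singular part of the second representation is negligible
  against x^\<alpha>. Subtraction leaves the analytic function h - g with radial order \<alpha>,
  which is no natural number.\<close>

lemma has_singularity_type_le:
  assumes "has_singularity_type F \<rho> \<alpha>" "has_singularity_type F \<rho> \<beta>"
  shows "\<beta> \<le> \<alpha>"
proof (rule ccontr)
  assume "\<not> \<beta> \<le> \<alpha>"
  hence less: "\<beta> - \<alpha> > 0" by simp
  have \<rho>: "\<rho> \<noteq> 0" and \<alpha>: "\<alpha> \<notin> \<nat>" using assms(1) by (auto simp: has_singularity_type_def)
  obtain g c where g: "g analytic_on {\<rho>}" and c: "c \<noteq> 0" and
    lim1: "((\<lambda>x. (eval_fps F (\<rho> * (1 - of_real x)) - g (\<rho> * (1 - of_real x))) / of_real (x powr \<alpha>)) \<longlongrightarrow> c) (at_right 0)"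
    using has_singularity_type_radial[OF assms(1)] .
  obtain h d where h: "h analytic_on {\<rho>}" and
    lim2: "((\<lambda>x. (eval_fps F (\<rho> * (1 - of_real x)) - h (\<rho> * (1 - of_real x))) / of_real (x powr \<beta>)) \<longlongrightarrow> d) (at_right 0)"
    using has_singularity_type_radial[OF assms(2)] .
  have "((\<lambda>x::real. x powr (\<beta> - \<alpha>)) \<longlongrightarrow> 0) (at_right 0)" using less by real_asymp
  hence "((\<lambda>x. complex_of_real (x powr (\<beta> - \<alpha>))) \<longlongrightarrow> of_real 0) (at_right 0)" by (intro tendsto_of_real)
  from tendsto_diff[OF lim1 tendsto_mult[OF lim2 this]]
  have lim: "((\<lambda>x. (eval_fps F (\<rho> * (1 - of_real x)) - g (\<rho> * (1 - of_real x))) / of_real (x powr \<alpha>) -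
     (eval_fps F (\<rho> * (1 - of_real x)) - h (\<rho> * (1 - of_real x))) / of_real (x powr \<beta>) * complex_of_real (x powr (\<beta> - \<alpha>))) \<longlongrightarrow> c) (at_right 0)"
    by simp
  have "((\<lambda>x. (h (\<rho> * (1 - of_real x)) - g (\<rho> * (1 - of_real x))) / of_real (x powr \<alpha>)) \<longlongrightarrow> c) (at_right 0)"
  proof (rule Lim_transform_eventually[OF lim])
    show "\<forall>\<^sub>F x in at_right 0. (eval_fps F (\<rho> * (1 - of_real x)) - g (\<rho> * (1 - of_real x))) / of_real (x powr \<alpha>) -
     (eval_fps F (\<rho> * (1 - of_real x)) - h (\<rho> * (1 - of_real x))) / of_real (x powr \<beta>) * complex_of_real (x powr (\<beta> - \<alpha>)) =
       (h (\<rho> * (1 - of_real x)) - g (\<rho> * (1 - of_real x))) / of_real (x powr \<alpha>)"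
      using eventually_at_right_less[of 0]
    proof eventually_elim
      case (elim x)
      have *: "complex_of_real (x powr (\<beta> - \<alpha>)) = of_real (x powr \<beta>) / of_real (x powr \<alpha>)"
        by (simp add: powr_diff)
      have **: "a / A - b / B * (B / A) = (a - b) / A" if "B \<noteq> 0" for a b A B :: complex
        using that by (simp add: diff_divide_distrib)
      show ?case unfolding * by (subst **) (use elim in auto)
    qed
  qed
  hence "\<alpha> \<in> \<nat>"
    by (intro analytic_radial_order[of "\<lambda>z. h z - g z" \<rho> c] analytic_on_diff g h \<rho> c)
  with \<alpha> show False ..
qed

lemma has_singularity_type_unique:
  "has_singularity_type F \<rho> \<alpha> \<Longrightarrow> has_singularity_type F \<rho> \<beta> \<Longrightarrow> \<alpha> = \<beta>"
  by (simp add: has_singularity_type_le order.antisym)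

section \<open>Propagation of the singularity type\<close>

(* As in has_singularity_type, for a function given on the closed disc.  The regular part g has to
   take the value f \<rho>, which decides whether the next radicand vanishes at \<rho>. *)
definition branch_type :: "(complex \<Rightarrow> complex) \<Rightarrow> complex \<Rightarrow> real \<Rightarrow> bool" where
  "branch_type f \<rho> \<alpha> \<longleftrightarrow>
     (\<exists>\<epsilon> F g c. \<epsilon> > 0 \<and> F holomorphic_on slit_domain \<rho> \<epsilon> \<and> (\<forall>z\<in>ball 0 (norm \<rho>). F z = f z) \<and>
        g analytic_on {\<rho>} \<and> g \<rho> = f \<rho> \<and> c \<noteq> 0 \<and>
        ((\<lambda>z. (F z - g z) / (1 - z / \<rho>) powr of_real \<alpha>) \<longlongrightarrow> c) (at \<rho> within slit_domain \<rho> \<epsilon>))"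

lemma branch_typeI:
  assumes "\<epsilon> > 0" "F holomorphic_on slit_domain \<rho> \<epsilon>" "\<And>z. norm z < norm \<rho> \<Longrightarrow> F z = f z"
    "g analytic_on {\<rho>}" "g \<rho> = f \<rho>" "c \<noteq> 0"
    "((\<lambda>z. (F z - g z) / (1 - z / \<rho>) powr of_real \<alpha>) \<longlongrightarrow> c) (at \<rho> within slit_domain \<rho> \<epsilon>)"
  shows "branch_type f \<rho> \<alpha>"
  unfolding branch_type_def using assms by (intro exI[of _ \<epsilon>] exI[of _ F] exI[of _ g] exI[of _ c]) auto

lemma branch_typeE:
  assumes "branch_type f \<rho> \<alpha>"
  obtains \<epsilon> F g c where "\<epsilon> > 0" "F holomorphic_on slit_domain \<rho> \<epsilon>" "\<And>z. norm z < norm \<rho> \<Longrightarrow> F z = f z"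
    "g analytic_on {\<rho>}" "g \<rho> = f \<rho>" "c \<noteq> 0"
    "((\<lambda>z. (F z - g z) / (1 - z / \<rho>) powr of_real \<alpha>) \<longlongrightarrow> c) (at \<rho> within slit_domain \<rho> \<epsilon>)"
  using assms unfolding branch_type_def by auto

lemma eventually_slit_nonzero:
  assumes "\<rho> \<noteq> 0"
  shows "\<forall>\<^sub>F z in at \<rho> within slit_domain \<rho> \<epsilon>. 1 - z / \<rho> \<noteq> 0"
  unfolding eventually_at_filter
  using slit_domain_subset[OF assms, of \<epsilon>] by (intro always_eventually) auto

text \<open>The upper bound on the radius of convergence is the point: a larger radius would make
  the series analytic at \<rho>, and its difference from g would have the radial order
  \<alpha>.\<close>

lemma branch_type_imp_has_singularity_type:
  assumes "branch_type f \<rho> \<alpha>" "\<rho> \<noteq> 0" "\<alpha> \<notin> \<nat>" "fps_conv_radius A \<ge> norm \<rho>"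
    "\<And>z. norm z < norm \<rho> \<Longrightarrow> eval_fps A z = f z"
  shows "has_singularity_type A \<rho> \<alpha>"
proof -
  obtain \<epsilon> F g c where F: "\<epsilon> > 0" "F holomorphic_on slit_domain \<rho> \<epsilon>" "\<And>z. norm z < norm \<rho> \<Longrightarrow> F z = f z"
    "g analytic_on {\<rho>}" "g \<rho> = f \<rho>" "c \<noteq> 0"
    and lim: "((\<lambda>z. (F z - g z) / (1 - z / \<rho>) powr of_real \<alpha>) \<longlongrightarrow> c) (at \<rho> within slit_domain \<rho> \<epsilon>)"
    using branch_typeE[OF assms(1)] by blast
  have "(\<lambda>z. (F z - g z)) \<sim>[at \<rho> within slit_domain \<rho> \<epsilon>] (\<lambda>z. c * (1 - z / \<rho>) powr of_real \<alpha>)"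
  proof (rule asymp_equivI')
    from tendsto_divide[OF lim tendsto_const[of c]]
    show "((\<lambda>z. (F z - g z) / (c * (1 - z / \<rho>) powr of_real \<alpha>)) \<longlongrightarrow> 1) (at \<rho> within slit_domain \<rho> \<epsilon>)"
      using F(6) by (simp add: mult.commute)
  qed
  moreover have "fps_conv_radius A \<le> norm \<rho>"
  proof (rule ccontr)
    assume "\<not> fps_conv_radius A \<le> norm \<rho>"
    hence "eval_fps A analytic_on {\<rho>}"
      by (intro analytic_on_eval_fps) auto
    hence "(\<lambda>z. eval_fps A z - g z) analytic_on {\<rho>}" by (intro analytic_on_diff F)
    moreover from filterlim_compose[OF lim filterlim_radial[OF assms(2) F(1)]]
    have lim': "((\<lambda>x. (F (\<rho> * (1 - of_real x)) - g (\<rho> * (1 - of_real x))) / (of_real x) powr of_real \<alpha>) \<longlongrightarrow> c) (at_right 0)"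
      using assms(2) by simp
    have "((\<lambda>x. (eval_fps A (\<rho> * (1 - of_real x)) - g (\<rho> * (1 - of_real x))) / of_real (x powr \<alpha>)) \<longlongrightarrow> c) (at_right 0)"
    proof (rule Lim_transform_eventually[OF lim'])
      show "\<forall>\<^sub>F x in at_right 0. (F (\<rho> * (1 - of_real x)) - g (\<rho> * (1 - of_real x))) / (of_real x) powr of_real \<alpha> =
          (eval_fps A (\<rho> * (1 - of_real x)) - g (\<rho> * (1 - of_real x))) / of_real (x powr \<alpha>)"
        using eventually_norm_radial_less[OF assms(2)] eventually_at_right_less[of 0]
        by eventually_elim (use F(3) assms(5) in \<open>simp add: powr_of_real\<close>)
    qed
    ultimately have "\<alpha> \<in> \<nat>" using analytic_radial_order assms(2) F(6) by blast
    with assms(3) show False ..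
  qed
  ultimately show ?thesis
    unfolding has_singularity_type_def using assms F
    by (intro conjI exI[of _ \<epsilon>] exI[of _ F] exI[of _ g] exI[of _ c]) auto
qed

lemma branch_type_tendsto:
  assumes "\<rho> \<noteq> 0" "\<alpha> > 0" "g analytic_on {\<rho>}"
    "((\<lambda>z. (F z - g z) / (1 - z / \<rho>) powr of_real \<alpha>) \<longlongrightarrow> c) (at \<rho> within slit_domain \<rho> \<epsilon>)"
  shows "(F \<longlongrightarrow> g \<rho>) (at \<rho> within slit_domain \<rho> \<epsilon>)"
proof -
  let ?F = "at \<rho> within slit_domain \<rho> \<epsilon>"
  have "isCont g \<rho>" using assms(3) by (simp add: analytic_at_imp_isCont)
  hence g: "(g \<longlongrightarrow> g \<rho>) ?F" by (metis continuous_at_imp_continuous_at_within continuous_within)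
  have "((\<lambda>z. 1 - z / \<rho>) \<longlongrightarrow> 1 - \<rho> / \<rho>) ?F" by (intro tendsto_intros assms)
  hence "((\<lambda>z. norm (1 - z / \<rho>) powr \<alpha>) \<longlongrightarrow> norm (0 :: complex) powr \<alpha>) ?F"
    using assms by (intro tendsto_powr' tendsto_norm tendsto_const) auto
  hence "((\<lambda>z. norm ((1 - z / \<rho>) powr of_real \<alpha>)) \<longlongrightarrow> 0) ?F"
    using assms by (simp add: norm_powr_real_powr')
  hence "((\<lambda>z. (1 - z / \<rho>) powr of_real \<alpha>) \<longlongrightarrow> 0) ?F" by (rule tendsto_norm_zero_cancel)
  from tendsto_add[OF g tendsto_mult[OF assms(4) this]]
  have "((\<lambda>z. g z + (F z - g z) / (1 - z / \<rho>) powr of_real \<alpha> * (1 - z / \<rho>) powr of_real \<alpha>) \<longlongrightarrow> g \<rho>) ?F"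
    by simp
  thus ?thesis
  proof (rule Lim_transform_eventually)
    show "\<forall>\<^sub>F z in ?F. g z + (F z - g z) / (1 - z / \<rho>) powr of_real \<alpha> * (1 - z / \<rho>) powr of_real \<alpha> = F z"
      using eventually_slit_nonzero[OF assms(1), of \<epsilon>] by eventually_elim simp
  qed
qed

lemma open_slit_domain: "\<rho> \<noteq> 0 \<Longrightarrow> open (slit_domain \<rho> \<epsilon>)"
  using open_Int[OF open_ball[of \<rho> \<epsilon>] open_slit[of \<rho>]]
  by (subst slit_domain_eq) (auto simp: Int_def)

lemma branch_type_divide:
  assumes "branch_type q \<rho> \<alpha>" "\<rho> \<noteq> 0" "p holomorphic_on ball 0 (norm \<rho>)" "\<And>z. 1 - q z = 2 * z * p z"
  shows "branch_type p \<rho> \<alpha>"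
proof -
  obtain \<epsilon> F g c where \<epsilon>: "\<epsilon> > 0" and F: "F holomorphic_on slit_domain \<rho> \<epsilon>" and Fq: "\<And>z. norm z < norm \<rho> \<Longrightarrow> F z = q z"
    and g: "g analytic_on {\<rho>}" and gq: "g \<rho> = q \<rho>" and c: "c \<noteq> 0"
    and lim: "((\<lambda>z. (F z - g z) / (1 - z / \<rho>) powr of_real \<alpha>) \<longlongrightarrow> c) (at \<rho> within slit_domain \<rho> \<epsilon>)"
    using branch_typeE[OF assms(1)] by blast
  let ?S = "slit_domain \<rho> \<epsilon>"
  let ?B = "ball 0 (norm \<rho>) :: complex set"
  \<comment> \<open>The quotient takes a default value at 0, so p itself is used on the disc; away
    from 0 the two expressions agree.\<close>
  define P where "P z = (if z \<in> ?B then p z else (1 - F z) / (2 * z))" for z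
  have P: "P z = (1 - F z) / (2 * z)" if "z \<noteq> 0" for z
    using assms(4)[of z] Fq[of z] that by (auto simp: P_def)
  show ?thesis
  proof (rule branch_typeI[OF \<epsilon>])
    have "(\<lambda>z. if z \<in> ?B then p z else (1 - F z) / (2 * z)) holomorphic_on ?B \<union> (?S - {0})"
    proof (rule holomorphic_on_If_Un)
      show "(\<lambda>z. (1 - F z) / (2 * z)) holomorphic_on ?S - {0}"
        by (intro holomorphic_intros holomorphic_on_subset[OF F]) auto
      show "open (?S - {0})" using open_slit_domain[OF assms(2)] by (intro open_delete)
      show "p z = (1 - F z) / (2 * z)" if "z \<in> ?B" "z \<in> ?S - {0}" for z
        using that P[of z] by (simp add: P_def)
    qed (use assms(3) in auto)
    moreover have "?B \<union> (?S - {0}) = ?S" using assms(2) by (auto simp: slit_domain_def)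
    ultimately show "P holomorphic_on ?S" by (simp add: P_def[abs_def])
    show "P z = p z" if "norm z < norm \<rho>" for z using that by (simp add: P_def)
    show "(\<lambda>z. (1 - g z) / (2 * z)) analytic_on {\<rho>}"
      by (intro analytic_intros g) (use assms(2) in auto)
    show "(1 - g \<rho>) / (2 * \<rho>) = p \<rho>" using assms(2,4) gq by (simp add: field_simps)
    show "- c / (2 * \<rho>) \<noteq> 0" using c assms(2) by simp
    have "((\<lambda>z. - ((F z - g z) / (1 - z / \<rho>) powr of_real \<alpha>) / (2 * z)) \<longlongrightarrow> - c / (2 * \<rho>)) (at \<rho> within ?S)"
      by (intro tendsto_intros lim) (use assms(2) in auto)
    thus "((\<lambda>z. (P z - (1 - g z) / (2 * z)) / (1 - z / \<rho>) powr of_real \<alpha>) \<longlongrightarrow> - c / (2 * \<rho>)) (at \<rho> within ?S)"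
    proof (rule Lim_transform_eventually)
      have "\<forall>\<^sub>F z in at \<rho> within ?S. z \<in> - {0}"
        using assms(2) by (intro topological_tendstoD[OF tendsto_ident_at]) auto
      thus "\<forall>\<^sub>F z in at \<rho> within ?S. - ((F z - g z) / (1 - z / \<rho>) powr of_real \<alpha>) / (2 * z) =
        (P z - (1 - g z) / (2 * z)) / (1 - z / \<rho>) powr of_real \<alpha>"
      proof eventually_elim
        case (elim z)
        hence "P z - (1 - g z) / (2 * z) = - (F z - g z) / (2 * z)" by (simp add: P diff_divide_distrib)
        thus ?case by (simp only: divide_divide_eq_left divide_minus_left mult.commute)
      qed
    qed
  qed
qed

lemma holomorphic_slit_domain_shrink:
  assumes "\<rho> \<noteq> 0" "\<epsilon> > 0" "F holomorphic_on slit_domain \<rho> \<epsilon>" "A holomorphic_on UNIV"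
    "\<And>z. norm z < norm \<rho> \<Longrightarrow> A z + 2 * z * F z \<notin> \<real>\<^sub>\<le>\<^sub>0"
    "\<forall>\<^sub>F z in at \<rho> within slit_domain \<rho> \<epsilon>. A z + 2 * z * F z \<notin> \<real>\<^sub>\<le>\<^sub>0"
  obtains \<epsilon>' where "\<epsilon>' > 0" "(\<lambda>z. csqrt (A z + 2 * z * F z)) holomorphic_on slit_domain \<rho> \<epsilon>'"
    "at \<rho> within slit_domain \<rho> \<epsilon>' = at \<rho> within slit_domain \<rho> \<epsilon>"
proof -
  obtain \<epsilon>' where \<epsilon>': "0 < \<epsilon>'" "\<epsilon>' \<le> \<epsilon>"
    and *: "\<And>z. z \<in> slit_domain \<rho> \<epsilon>' \<Longrightarrow> z \<notin> ball 0 (norm \<rho>) \<Longrightarrow> A z + 2 * z * F z \<notin> \<real>\<^sub>\<le>\<^sub>0"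
    using eventually_at_slit_domain[OF assms(1,2,6)] by blast
  have nz: "A z + 2 * z * F z \<notin> \<real>\<^sub>\<le>\<^sub>0" if "z \<in> slit_domain \<rho> \<epsilon>'" for z
    using *[OF that] assms(5)[of z] by auto
  show ?thesis
  proof (rule that[OF \<epsilon>'(1)])
    show "(\<lambda>z. csqrt (A z + 2 * z * F z)) holomorphic_on slit_domain \<rho> \<epsilon>'"
      by (intro holomorphic_intros holomorphic_on_subset[OF assms(3) slit_domain_mono[OF \<epsilon>'(2)]]
            holomorphic_on_subset[OF assms(4)] nz) auto
    show "at \<rho> within slit_domain \<rho> \<epsilon>' = at \<rho> within slit_domain \<rho> \<epsilon>"
      using at_slit_domain[OF assms(1)] assms(2) \<epsilon>'(1) by simp
  qed
qed

text \<open>The difference of two roots is the difference of the radicands over the sum of the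
  roots, and this sum tends to 2 csqrt (R \<rho>), which is not 0. So the exponent survives, and the
  new regular part again has the right value at \<rho>.\<close>

lemma branch_type_csqrt:
  assumes "branch_type q \<rho> \<alpha>" "\<rho> \<noteq> 0" "\<alpha> > 0" "A holomorphic_on UNIV"
    "\<And>z. R z = A z + 2 * z * q z"
    "\<And>z. norm z < norm \<rho> \<Longrightarrow> R z \<notin> \<real>\<^sub>\<le>\<^sub>0" "R \<rho> \<notin> \<real>\<^sub>\<le>\<^sub>0"
  shows "branch_type (\<lambda>z. csqrt (R z)) \<rho> \<alpha>"
proof -
  obtain \<epsilon> F g c where \<epsilon>: "\<epsilon> > 0" and F: "F holomorphic_on slit_domain \<rho> \<epsilon>" and Fq: "\<And>z. norm z < norm \<rho> \<Longrightarrow> F z = q z"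
    and g: "g analytic_on {\<rho>}" and gq: "g \<rho> = q \<rho>" and c: "c \<noteq> 0"
    and lim: "((\<lambda>z. (F z - g z) / (1 - z / \<rho>) powr of_real \<alpha>) \<longlongrightarrow> c) (at \<rho> within slit_domain \<rho> \<epsilon>)"
    using branch_typeE[OF assms(1)] by blast
  let ?F = "at \<rho> within slit_domain \<rho> \<epsilon>"
  have A: "A analytic_on {\<rho>}" using assms(4) by (metis analytic_on_open analytic_on_subset open_UNIV subset_UNIV)
  have "isCont A \<rho>" using A by (simp add: analytic_at_imp_isCont)
  hence Alim: "(A \<longlongrightarrow> A \<rho>) ?F" by (metis continuous_at_imp_continuous_at_within continuous_within)
  have "isCont g \<rho>" using g by (simp add: analytic_at_imp_isCont)
  hence glim: "(g \<longlongrightarrow> g \<rho>) ?F" by (metis continuous_at_imp_continuous_at_within continuous_within)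
  have Flim: "(F \<longlongrightarrow> g \<rho>) ?F" by (rule branch_type_tendsto[OF assms(2,3) g lim])
  define RF where "RF z = A z + 2 * z * F z" for z
  define Rg where "Rg z = A z + 2 * z * g z" for z
  have Rg\<rho>: "Rg \<rho> = R \<rho>" by (simp add: Rg_def gq assms(5))
  have "(RF \<longlongrightarrow> A \<rho> + 2 * \<rho> * g \<rho>) ?F" unfolding RF_def by (intro tendsto_intros Alim Flim)
  hence RFlim: "(RF \<longlongrightarrow> R \<rho>) ?F" by (simp add: assms(5) gq)
  have "(Rg \<longlongrightarrow> A \<rho> + 2 * \<rho> * g \<rho>) ?F" unfolding Rg_def by (intro tendsto_intros Alim glim)
  hence Rglim: "(Rg \<longlongrightarrow> R \<rho>) ?F" by (simp add: assms(5) gq)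
  have sq: "((\<lambda>z. csqrt (f z)) \<longlongrightarrow> csqrt (R \<rho>)) ?F" if "(f \<longlongrightarrow> R \<rho>) ?F" for f
    using isCont_tendsto_compose[OF continuous_at_csqrt[OF assms(7)] that] .
  have "\<forall>\<^sub>F z in ?F. RF z \<in> - \<real>\<^sub>\<le>\<^sub>0"
    by (rule topological_tendstoD[OF RFlim]) (use assms(7) in auto)
  then obtain \<epsilon>' where \<epsilon>': "\<epsilon>' > 0" "(\<lambda>z. csqrt (RF z)) holomorphic_on slit_domain \<rho> \<epsilon>'"
    and F_eq: "at \<rho> within slit_domain \<rho> \<epsilon>' = ?F"
    using holomorphic_slit_domain_shrink[OF assms(2) \<epsilon> F assms(4)] assms(5,6) Fq unfolding RF_def
    by auto
  have R0: "R \<rho> \<noteq> 0" using assms(7) by auto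
  show ?thesis
  proof (rule branch_typeI[OF \<epsilon>'])
    show "csqrt (RF z) = csqrt (R z)" if "norm z < norm \<rho>" for z using that by (simp add: RF_def Fq assms(5))
    show "(\<lambda>z. csqrt (Rg z)) analytic_on {\<rho>}" unfolding Rg_def
      by (intro analytic_intros A g) (use assms(7) Rg\<rho> in \<open>simp add: Rg_def\<close>)
    show "csqrt (Rg \<rho>) = csqrt (R \<rho>)" by (simp add: Rg\<rho>)
    show "2 * \<rho> * c / (csqrt (R \<rho>) + csqrt (R \<rho>)) \<noteq> 0" using R0 c assms(2) by (simp del: csqrt.simps)
    have *: "((\<lambda>z. csqrt (RF z) + csqrt (Rg z)) \<longlongrightarrow> csqrt (R \<rho>) + csqrt (R \<rho>)) ?F"
      by (intro tendsto_add sq RFlim Rglim)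
    have ne: "csqrt (R \<rho>) + csqrt (R \<rho>) \<noteq> 0" using R0 by (simp del: csqrt.simps)
    have "((\<lambda>z. 2 * z * ((F z - g z) / (1 - z / \<rho>) powr of_real \<alpha>) / (csqrt (RF z) + csqrt (Rg z))) \<longlongrightarrow>
        2 * \<rho> * c / (csqrt (R \<rho>) + csqrt (R \<rho>))) ?F"
      by (intro tendsto_intros lim * ne)
    thus "((\<lambda>z. (csqrt (RF z) - csqrt (Rg z)) / (1 - z / \<rho>) powr of_real \<alpha>) \<longlongrightarrow>
        2 * \<rho> * c / (csqrt (R \<rho>) + csqrt (R \<rho>))) (at \<rho> within slit_domain \<rho> \<epsilon>')"
      unfolding F_eq
    proof (rule Lim_transform_eventually)
      show "\<forall>\<^sub>F z in ?F. 2 * z * ((F z - g z) / (1 - z / \<rho>) powr of_real \<alpha>) / (csqrt (RF z) + csqrt (Rg z)) =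
         (csqrt (RF z) - csqrt (Rg z)) / (1 - z / \<rho>) powr of_real \<alpha>"
        using tendsto_imp_eventually_ne[OF * ne]
      proof eventually_elim
        case (elim z)
        have "(csqrt (RF z) - csqrt (Rg z)) * (csqrt (RF z) + csqrt (Rg z)) = (csqrt (RF z))\<^sup>2 - (csqrt (Rg z))\<^sup>2"
          by (simp add: power2_eq_square algebra_simps del: csqrt.simps power2_csqrt)
        also have "\<dots> = 2 * z * (F z - g z)" by (simp add: RF_def Rg_def algebra_simps)
        finally have "csqrt (RF z) - csqrt (Rg z) = 2 * z * (F z - g z) / (csqrt (RF z) + csqrt (Rg z))"
          using elim by (simp add: eq_divide_eq)
        thus ?case by simp
      qed
    qed
  qed
qed

section \<open>Local behaviour at a vanishing radicand: the exponents 1/2 and 1/4\<close>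

lemma csqrt_mult_Re_pos:
  assumes "Re u > 0" "Re v > 0"
  shows "csqrt (u * v) = csqrt u * csqrt v" "u * v \<notin> \<real>\<^sub>\<le>\<^sub>0"
proof -
  have *: "\<bar>Arg z\<bar> < pi / 2" if "Re z > 0" for z
  proof -
    have "z \<noteq> 0" using that by auto
    thus ?thesis using Re_Ln_pos_lt[of z] Arg_eq_Im_Ln[of z] that by metis
  qed
  \<comment> \<open>Each argument lies strictly between -pi/2 and pi/2, so their sum needs no
    reduction modulo 2 pi.\<close>
  have "Arg u + Arg v \<in> {- pi<..pi}"
    using *[OF assms(1)] *[OF assms(2)] unfolding greaterThanAtMost_iff by linarith
  thus "csqrt (u * v) = csqrt u * csqrt v" by (rule csqrt_mult)
  show "u * v \<notin> \<real>\<^sub>\<le>\<^sub>0"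
  proof
    assume "u * v \<in> \<real>\<^sub>\<le>\<^sub>0"
    hence uv: "Re (u * v) \<le> 0" "Im (u * v) = 0" unfolding complex_nonpos_Reals_iff by blast+
    \<comment> \<open>This is the real part of cnj u * (u * v) = |u|^2 v.\<close>
    have "Re u * Re (u * v) = (Re u)\<^sup>2 * Re v + (Im u)\<^sup>2 * Re v - Im u * Im (u * v)"
      by (simp add: algebra_simps power2_eq_square)
    moreover have "(Re u)\<^sup>2 * Re v > 0" "(Im u)\<^sup>2 * Re v \<ge> 0" using assms by simp_all
    moreover have "Re u * Re (u * v) \<le> 0" by (rule mult_nonneg_nonpos) (use assms uv in linarith)+
    moreover have "Im u * Im (u * v) = 0" unfolding uv(2) by simp
    ultimately show False by linarith
  qed
qed

(* Building the continuation from R z = w z (1 - z/\<rho>), with w close to the positive number d,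
   avoids having to show that R takes no values in the branch cut off the slit. *)
lemma simple_zero_csqrt:
  assumes "\<rho> \<noteq> 0" "R holomorphic_on ball 0 (norm \<rho>)" "R analytic_on {\<rho>}" "R \<rho> = 0"
    "(R has_field_derivative - of_real d / \<rho>) (at \<rho>)" "d > 0"
    "\<And>z. norm z < norm \<rho> \<Longrightarrow> R z \<notin> \<real>\<^sub>\<le>\<^sub>0"
  obtains \<epsilon> F where "\<epsilon> > 0" "F holomorphic_on slit_domain \<rho> \<epsilon>" "\<And>z. norm z < norm \<rho> \<Longrightarrow> F z = csqrt (R z)"
    "((\<lambda>z. F z / csqrt (1 - z / \<rho>)) \<longlongrightarrow> of_real (sqrt d)) (at \<rho> within slit_domain \<rho> \<epsilon>)"
proof -
  obtain e where e: "e > 0" "R holomorphic_on ball \<rho> e" using assms(3) by (auto simp: analytic_on_def)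
  \<comment> \<open>The difference quotient with its singularity removed; the factor -\<rho> turns z
    - \<rho> into 1 - z / \<rho> and the derivative -d / \<rho> into the value d.\<close>
  define w where "w z = - \<rho> * (if z = \<rho> then deriv R \<rho> else (R z - R \<rho>) / (z - \<rho>))" for z
  have w_hol: "w holomorphic_on ball \<rho> e"
    unfolding w_def by (intro holomorphic_intros pole_lemma_open e) auto
  have w\<rho>: "w \<rho> = of_real d" using DERIV_imp_deriv[OF assms(5)] assms(1) by (simp add: w_def)
  have Rw: "R z = w z * (1 - z / \<rho>)" for z
  proof (cases "z = \<rho>")
    case False
    hence "w z * (1 - z / \<rho>) = (R z / (z - \<rho>)) * (- \<rho> * (1 - z / \<rho>))" by (simp add: w_def assms(4))
    also have "- \<rho> * (1 - z / \<rho>) = z - \<rho>" using assms(1) by (simp add: algebra_simps)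
    finally show ?thesis using False by simp
  qed (use assms in simp)
  have "isCont w \<rho>"
    using w_hol e(1) by (metis analytic_at_imp_isCont analytic_at open_ball centre_in_ball)
  hence wlim: "(w \<longlongrightarrow> of_real d) (at \<rho>)" by (simp add: isCont_def w\<rho>)
  have "\<forall>\<^sub>F z in at \<rho>. Re (w z) > 0"
    by (rule order_tendstoD[OF tendsto_Re[OF wlim]]) (use assms(6) in simp)
  then obtain e' where e': "e' > 0" "\<And>z. z \<noteq> \<rho> \<Longrightarrow> dist z \<rho> < e' \<Longrightarrow> Re (w z) > 0"
    unfolding eventually_at by blast
  define \<epsilon> where "\<epsilon> = min e e'"
  have \<epsilon>: "\<epsilon> > 0" using e e' by (simp add: \<epsilon>_def)
  have Re_w: "Re (w z) > 0" if "z \<in> ball \<rho> \<epsilon>" for z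
    using e'(2)[of z] that w\<rho> assms(6) by (cases "z = \<rho>") (auto simp: \<epsilon>_def dist_commute)
  let ?B = "ball 0 (norm \<rho>) :: complex set"
  let ?S = "{z \<in> ball \<rho> \<epsilon>. 1 - z / \<rho> \<notin> \<real>\<^sub>\<le>\<^sub>0}"
  define F where "F z = (if z \<in> ?B then csqrt (R z) else csqrt (w z) * csqrt (1 - z / \<rho>))" for z
  \<comment> \<open>On the overlap both factors of R have positive real part, so the root of the
    product splits.\<close>
  have agree: "csqrt (R z) = csqrt (w z) * csqrt (1 - z / \<rho>)" if "z \<in> ?B" "z \<in> ball \<rho> \<epsilon>" for z
    unfolding Rw[of z] using that by (intro csqrt_mult_Re_pos Re_w Re_one_minus_pos) auto
  have Fw: "F z = csqrt (w z) * csqrt (1 - z / \<rho>)" if "z \<in> ball \<rho> \<epsilon>" for z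
    using agree[of z] that by (simp add: F_def del: csqrt.simps)
  have w_nz: "w z \<notin> \<real>\<^sub>\<le>\<^sub>0" if "z \<in> ball \<rho> \<epsilon>" for z
    using Re_w[OF that] by (auto simp: complex_nonpos_Reals_iff)
  show ?thesis
  proof (rule that[OF \<epsilon>])
    have "F holomorphic_on ?B \<union> ?S" unfolding F_def
    proof (rule holomorphic_on_If_Un)
      show "(\<lambda>z. csqrt (R z)) holomorphic_on ?B"
        by (intro holomorphic_intros assms) auto
      have "w holomorphic_on ?S" by (rule holomorphic_on_subset[OF w_hol]) (auto simp: \<epsilon>_def)
      thus "(\<lambda>z. csqrt (w z) * csqrt (1 - z / \<rho>)) holomorphic_on ?S"
        by (intro holomorphic_intros) (use w_nz assms(1) in auto)
      show "open ?S" using open_Int[OF open_ball[of \<rho> \<epsilon>] open_slit[OF assms(1)]] by (simp add: Int_def)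
      show "csqrt (R z) = csqrt (w z) * csqrt (1 - z / \<rho>)" if "z \<in> ?B" "z \<in> ?S" for z
        using that by (intro agree) auto
    qed auto
    thus "F holomorphic_on slit_domain \<rho> \<epsilon>" by (simp add: slit_domain_eq assms(1))
    show "F z = csqrt (R z)" if "norm z < norm \<rho>" for z using that by (simp add: F_def)
    have "((\<lambda>z. csqrt (w z)) \<longlongrightarrow> csqrt (of_real d)) (at \<rho>)"
      by (rule isCont_tendsto_compose[OF continuous_at_csqrt wlim]) (use assms(6) in auto)
    also have "csqrt (of_real d) = of_real (sqrt d)"
      by (rule csqrt_of_real) (use assms(6) in simp)
    finally have "((\<lambda>z. csqrt (w z)) \<longlongrightarrow> of_real (sqrt d)) (at \<rho> within slit_domain \<rho> \<epsilon>)"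
      by (rule tendsto_within_subset[OF _ subset_UNIV])
    thus "((\<lambda>z. F z / csqrt (1 - z / \<rho>)) \<longlongrightarrow> of_real (sqrt d)) (at \<rho> within slit_domain \<rho> \<epsilon>)"
    proof (rule Lim_transform_eventually)
      have "\<forall>\<^sub>F z in at \<rho> within slit_domain \<rho> \<epsilon>. z \<in> ball \<rho> \<epsilon>"
        using \<epsilon> by (intro topological_tendstoD[OF tendsto_ident_at]) auto
      thus "\<forall>\<^sub>F z in at \<rho> within slit_domain \<rho> \<epsilon>. csqrt (w z) = F z / csqrt (1 - z / \<rho>)"
        using eventually_slit_nonzero[OF assms(1), of \<epsilon>]
        by eventually_elim (simp add: Fw del: csqrt.simps)
    qed
  qed
qed

lemma branch_type_half:
  assumes "\<rho> \<noteq> 0" "R holomorphic_on ball 0 (norm \<rho>)" "R analytic_on {\<rho>}" "R \<rho> = 0"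
    "(R has_field_derivative - of_real d / \<rho>) (at \<rho>)" "d > 0"
    "\<And>z. norm z < norm \<rho> \<Longrightarrow> R z \<notin> \<real>\<^sub>\<le>\<^sub>0"
  shows "branch_type (\<lambda>z. csqrt (R z)) \<rho> (1 / 2)"
proof -
  obtain \<epsilon> F where F: "\<epsilon> > 0" "F holomorphic_on slit_domain \<rho> \<epsilon>" "\<And>z. norm z < norm \<rho> \<Longrightarrow> F z = csqrt (R z)"
    "((\<lambda>z. F z / csqrt (1 - z / \<rho>)) \<longlongrightarrow> of_real (sqrt d)) (at \<rho> within slit_domain \<rho> \<epsilon>)"
    using simple_zero_csqrt[OF assms] by blast
  show ?thesis
  proof (rule branch_typeI[OF F(1-3)])
    show "(\<lambda>z. 0) analytic_on {\<rho>}" "0 = csqrt (R \<rho>)" "complex_of_real (sqrt d) \<noteq> 0"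
      using assms(4,6) by auto
    show "((\<lambda>z. (F z - 0) / (1 - z / \<rho>) powr of_real (1 / 2)) \<longlongrightarrow> of_real (sqrt d)) (at \<rho> within slit_domain \<rho> \<epsilon>)"
      using F(4) by (simp add: csqrt_conv_powr)
  qed
qed

lemma powr_quarter:
  fixes z :: complex
  assumes "z \<noteq> 0"
  shows "z powr (1 / 4) = csqrt (csqrt z)"
proof -
  have ln: "ln (csqrt z) = ln z / 2"
    unfolding csqrt_exp_Ln[OF assms] using Im_Ln_le_pi[OF assms] mpi_less_Im_Ln[OF assms] pi_gt_zero
    by (intro Ln_exp) (auto simp: field_simps)
  have "csqrt (csqrt z) = exp (ln z / 2 / 2)"
    unfolding ln[symmetric] by (rule csqrt_exp_Ln) (use assms in \<open>simp del: csqrt.simps\<close>)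
  also have "\<dots> = z powr (1 / 4)" using assms by (simp add: powr_def)
  finally show ?thesis by (rule sym)
qed

text \<open>Near \<rho> the term A is of first order, while 2 z csqrt (R z) is of order 1/2 and
  prevails. So the outer radicand behaves like C (1 - z/\<rho>)^(1/2), and its root has exponent
  1/4.\<close>

lemma branch_type_quarter:
  assumes "r > 0" "R holomorphic_on ball 0 r" "R analytic_on {of_real r}" "R (of_real r) = 0"
    "(R has_field_derivative - of_real d / of_real r) (at (of_real r))" "d > 0"
    "\<And>z. norm z < r \<Longrightarrow> R z \<notin> \<real>\<^sub>\<le>\<^sub>0"
    "A holomorphic_on UNIV" "A (of_real r) = 0" "\<And>z. R' z = A z + 2 * z * csqrt (R z)"
    "\<And>z. norm z < r \<Longrightarrow> R' z \<notin> \<real>\<^sub>\<le>\<^sub>0"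
  shows "branch_type (\<lambda>z. csqrt (R' z)) (of_real r) (1 / 4)"
proof -
  define \<rho> where "\<rho> = complex_of_real r"
  have \<rho>: "\<rho> \<noteq> 0" "norm \<rho> = r" using assms(1) by (auto simp: \<rho>_def)
  obtain \<epsilon> F where \<epsilon>: "\<epsilon> > 0" and F: "F holomorphic_on slit_domain \<rho> \<epsilon>" and FR: "\<And>z. norm z < r \<Longrightarrow> F z = csqrt (R z)"
    and lim: "((\<lambda>z. F z / csqrt (1 - z / \<rho>)) \<longlongrightarrow> of_real (sqrt d)) (at \<rho> within slit_domain \<rho> \<epsilon>)"
    using simple_zero_csqrt[of \<rho> R d] assms(2-7) \<rho> by (auto simp: \<rho>_def)
  let ?F = "at \<rho> within slit_domain \<rho> \<epsilon>"
  define C where "C = 2 * r * sqrt d"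
  have C: "C > 0" using assms(1,6) by (simp add: C_def)
  define RF where "RF z = A z + 2 * z * F z" for z
  define u where "u z = RF z / csqrt (1 - z / \<rho>)" for z
  have "A field_differentiable at \<rho>"
    using assms(8) by (metis holomorphic_on_imp_differentiable_at open_UNIV UNIV_I)
  hence "(A has_field_derivative deriv A \<rho>) (at \<rho>)" by (simp add: field_differentiable_derivI)
  hence "((\<lambda>z. (A z - A \<rho>) / (z - \<rho>)) \<longlongrightarrow> deriv A \<rho>) (at \<rho>)"
    by (simp add: has_field_derivative_iff)
  hence "((\<lambda>z. A z / (z - \<rho>)) \<longlongrightarrow> deriv A \<rho>) (at \<rho>)"
    using assms(9) by (simp add: \<rho>_def)
  hence A1: "((\<lambda>z. A z / (z - \<rho>)) \<longlongrightarrow> deriv A \<rho>) ?F"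
    by (rule tendsto_within_subset[OF _ subset_UNIV])
  have "((\<lambda>z. 1 - z / \<rho>) \<longlongrightarrow> 1 - \<rho> / \<rho>) ?F" by (intro tendsto_intros \<rho>)
  hence "((\<lambda>z. sqrt (norm (1 - z / \<rho>))) \<longlongrightarrow> sqrt (norm (0 :: complex))) ?F"
    using \<rho> by (intro tendsto_real_sqrt tendsto_norm) auto
  hence "((\<lambda>z. norm (csqrt (1 - z / \<rho>))) \<longlongrightarrow> 0) ?F" by (simp del: csqrt.simps)
  hence s0: "((\<lambda>z. csqrt (1 - z / \<rho>)) \<longlongrightarrow> 0) ?F" by (rule tendsto_norm_zero_cancel)
  have "((\<lambda>z. - \<rho> * (A z / (z - \<rho>)) * csqrt (1 - z / \<rho>) + 2 * z * (F z / csqrt (1 - z / \<rho>))) \<longlongrightarrow>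
      - \<rho> * deriv A \<rho> * 0 + 2 * \<rho> * of_real (sqrt d)) ?F"
    by (intro tendsto_intros A1 s0 lim)
  hence "((\<lambda>z. - \<rho> * (A z / (z - \<rho>)) * csqrt (1 - z / \<rho>) + 2 * z * (F z / csqrt (1 - z / \<rho>))) \<longlongrightarrow> of_real C) ?F"
    by (simp add: C_def \<rho>_def)
  hence ulim: "(u \<longlongrightarrow> of_real C) ?F"
  proof (rule Lim_transform_eventually)
    show "\<forall>\<^sub>F z in ?F. - \<rho> * (A z / (z - \<rho>)) * csqrt (1 - z / \<rho>) + 2 * z * (F z / csqrt (1 - z / \<rho>)) = u z"
      using eventually_slit_nonzero[OF \<rho>(1), of \<epsilon>]
    proof eventually_elim
      case (elim z)
      define s where "s = csqrt (1 - z / \<rho>)"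
      have s: "s \<noteq> 0" "s\<^sup>2 = 1 - z / \<rho>" using elim by (auto simp: s_def simp del: csqrt.simps)
      have "z - \<rho> = - \<rho> * s\<^sup>2" unfolding s(2) using \<rho>(1) by (simp add: algebra_simps)
      hence "- \<rho> * (A z / (z - \<rho>)) * s = A z / s" using \<rho>(1) s(1) by (simp add: power2_eq_square)
      thus ?case by (simp only: u_def RF_def add_divide_distrib s_def[symmetric] times_divide_eq_right)
    qed
  qed
  have Re_u: "\<forall>\<^sub>F z in ?F. Re (u z) > 0"
    by (rule order_tendstoD[OF tendsto_Re[OF ulim]]) (use C in simp)
  have in_slit: "\<forall>\<^sub>F z in ?F. 1 - z / \<rho> \<notin> \<real>\<^sub>\<le>\<^sub>0"
    unfolding eventually_at_filter
    using slit_domain_subset[OF \<rho>(1), of \<epsilon>] by (intro always_eventually) auto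
  \<comment> \<open>Off the slit the root of 1 - z / \<rho> has positive real part, and u is close
    to C > 0; so their product \<open>RF\<close> avoids the branch cut and its root splits.\<close>
  have fact: "\<forall>\<^sub>F z in ?F. RF z \<notin> \<real>\<^sub>\<le>\<^sub>0 \<and> csqrt (u z) = csqrt (RF z) / csqrt (csqrt (1 - z / \<rho>))"
    using Re_u in_slit
  proof eventually_elim
    case (elim z)
    have s: "Re (csqrt (1 - z / \<rho>)) > 0"
    proof -
      define s where "s = csqrt (1 - z / \<rho>)"
      have "Re s \<noteq> 0"
      proof
        assume "Re s = 0"
        hence "s\<^sup>2 \<in> \<real>\<^sub>\<le>\<^sub>0" by (simp add: complex_nonpos_Reals_iff power2_eq_square)
        thus False using elim(2) by (simp add: s_def del: csqrt.simps)
      qed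
      thus ?thesis using Re_csqrt[of "1 - z / \<rho>"] by (simp add: s_def less_le del: csqrt.simps)
    qed
    hence "csqrt (1 - z / \<rho>) \<noteq> 0" by (metis zero_complex.sel(1) less_irrefl)
    moreover from this have "RF z = u z * csqrt (1 - z / \<rho>)" by (simp add: u_def del: csqrt.simps)
    ultimately show ?case using csqrt_mult_Re_pos[OF elim(1) s] by (simp del: csqrt.simps)
  qed
  have "\<forall>\<^sub>F z in ?F. A z + 2 * z * F z \<notin> \<real>\<^sub>\<le>\<^sub>0"
    using fact by eventually_elim (simp add: RF_def)
  then obtain \<epsilon>' where \<epsilon>': "\<epsilon>' > 0" "(\<lambda>z. csqrt (RF z)) holomorphic_on slit_domain \<rho> \<epsilon>'"
    and F_eq: "at \<rho> within slit_domain \<rho> \<epsilon>' = ?F"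
    using holomorphic_slit_domain_shrink[OF \<rho>(1) \<epsilon> F assms(8)] assms(10,11) FR \<rho> unfolding RF_def
    by auto
  show ?thesis unfolding \<rho>_def[symmetric]
  proof (rule branch_typeI[OF \<epsilon>'])
    show "csqrt (RF z) = csqrt (R' z)" if "norm z < norm \<rho>" for z
      using that \<rho> by (simp add: RF_def FR assms(10))
    show "(\<lambda>z. 0) analytic_on {\<rho>}" "0 = csqrt (R' \<rho>)" "csqrt (of_real C) \<noteq> 0"
      using C assms(4,9,10) by (auto simp: \<rho>_def simp del: csqrt.simps)
    have "((\<lambda>z. csqrt (u z)) \<longlongrightarrow> csqrt (of_real C)) ?F"
      by (rule isCont_tendsto_compose[OF continuous_at_csqrt ulim]) (use C in auto)
    thus "((\<lambda>z. (csqrt (RF z) - 0) / (1 - z / \<rho>) powr of_real (1 / 4)) \<longlongrightarrow> csqrt (of_real C))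
        (at \<rho> within slit_domain \<rho> \<epsilon>')"
      unfolding F_eq
    proof (rule Lim_transform_eventually)
      show "\<forall>\<^sub>F z in ?F. csqrt (u z) = (csqrt (RF z) - 0) / (1 - z / \<rho>) powr of_real (1 / 4)"
        using fact eventually_slit_nonzero[OF \<rho>(1), of \<epsilon>]
        by eventually_elim (simp add: powr_quarter del: csqrt.simps)
    qed
  qed
qed

section \<open>The dominant singularity\<close>

lemma dominant_singularity_unique:
  assumes "has_singularity_type F \<rho> \<alpha>"
    "\<And>\<rho>' \<beta>. has_singularity_type F \<rho>' \<beta> \<Longrightarrow> \<rho>' \<noteq> \<rho> \<Longrightarrow> \<alpha> < \<beta>"
  shows "{z. dominant_singularity F z} = {\<rho>}"
proof (intro equalityI subsetI)
  fix z assume "z \<in> {z. dominant_singularity F z}"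
  then obtain \<beta> where "has_singularity_type F z \<beta>" "\<beta> \<le> \<alpha>"
    using assms(1) by (auto simp: dominant_singularity_def)
  thus "z \<in> {\<rho>}" using assms(2)[of z \<beta>] by force
next
  fix z assume "z \<in> {\<rho>}"
  have "\<alpha> \<le> \<beta>" if "has_singularity_type F \<rho>' \<beta>" for \<rho>' \<beta>
    using has_singularity_type_unique[OF assms(1)] assms(2)[OF that] that by (cases "\<rho>' = \<rho>") force+
  thus "z \<in> {z. dominant_singularity F z}"
    using assms(1) \<open>z \<in> {\<rho>}\<close> by (auto simp: dominant_singularity_def)
qed

lemma quarter_not_nat: "(1 / 4 :: real) \<notin> \<nat>"
proof
  assume "(1 / 4 :: real) \<in> \<nat>"
  then obtain n where "1 / 4 = real n" by (elim Nats_cases)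
  hence "1 = 4 * n" by linarith
  thus False by presburger
qed

context radicand_disc
begin

text \<open>Each differentiation step adds only nonpositive terms, and the term -2 (1 - v) is
  strictly negative because v < 1. Therefore the innermost zero at r is simple.\<close>

lemma radicand_derivative:
  assumes "i \<le> k" "\<And>l. l < i \<Longrightarrow> radicand k (Suc l) (of_real r) \<noteq> 0"
  shows "\<exists>d>0. (radicand k (Suc i) has_field_derivative - of_real d) (at (of_real r))"
  using assms
proof (induction i)
  case 0
  have "((\<lambda>z. 1 - 4 * complex_of_nat k * z\<^sup>2) has_field_derivative - of_real (8 * real k * r)) (at (of_real r))"
    by (auto intro!: derivative_eq_intros)
  moreover have "8 * real k * r > 0" using k_pos r_pos by simp
  ultimately show ?case unfolding radicand.simps by blast
next
  case (Suc i)
  then obtain d where d: "d > 0" "(radicand k (Suc i) has_field_derivative - of_real d) (at (of_real r))"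
    by auto
  define m where "m = real k - real (Suc (Suc i)) + 1"
  define v where "v = sqrt (rval i r)"
  have i: "i \<le> k" "0 \<le> r" "r \<le> r" using Suc.prems r_pos by auto
  have nz: "radicand k (Suc i) (of_real r) \<noteq> 0" using Suc.prems by simp
  hence "rval i r \<noteq> 0" using radicand_eq_rval[OF i] by auto
  hence v: "v > 0" "v < 1" using rval_nonneg[OF i] rval_less_1[OF i(1) r_pos] by (auto simp: v_def)
  have cs: "csqrt (radicand k (Suc i) (of_real r)) = of_real v"
    using csqrt_radicand_of_real[OF i] by (simp only: v_def)
  have np: "radicand k (Suc i) (of_real r) \<notin> \<real>\<^sub>\<le>\<^sub>0"
    using radicand_nonpos_iff[of i "of_real r"] i nz by simp
  have "((\<lambda>z. csqrt (radicand k (Suc i) z)) has_field_derivative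
      - of_real d / (2 * csqrt (radicand k (Suc i) (of_real r)))) (at (of_real r))"
    by (rule has_field_derivative_csqrt'[OF d(2) np])
  hence D: "((\<lambda>z. csqrt (radicand k (Suc i) z)) has_field_derivative - of_real d / (2 * of_real v)) (at (of_real r))"
    by (simp only: cs)
  have "((\<lambda>z. 1 - 4 * of_real m * z\<^sup>2 - 2 * z + 2 * z * csqrt (radicand k (Suc i) z)) has_field_derivative
     - (4 * of_real m * (2 * of_real r)) - 2 + (2 * of_real v + 2 * of_real r * (- of_real d / (2 * of_real v)))) (at (of_real r))"
    by (rule derivative_eq_intros D refl | simp only: cs)+ (simp add: algebra_simps)
  also have "(\<lambda>z. 1 - 4 * of_real m * z\<^sup>2 - 2 * z + 2 * z * csqrt (radicand k (Suc i) z)) = radicand k (Suc (Suc i))"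
    by (simp add: fun_eq_iff radicand.simps(3) m_def)
  also have "- (4 * of_real m * (2 * of_real r)) - 2 + (2 * of_real v + 2 * of_real r * (- of_real d / (2 * of_real v))) =
     - complex_of_real (8 * m * r + 2 * (1 - v) + r * d / v)"
    using v by (simp add: field_simps)
  finally have "(radicand k (Suc (Suc i)) has_field_derivative - complex_of_real (8 * m * r + 2 * (1 - v) + r * d / v)) (at (of_real r))" .
  moreover have "8 * m * r \<ge> 0" "2 * (1 - v) > 0" "r * d / v > 0"
    using Suc.prems r_pos v d(1) by (auto simp: m_def)
  hence "8 * m * r + 2 * (1 - v) + r * d / v > 0" by linarith
  ultimately show ?case by blast
qed

lemma holomorphic_radicand: "i \<le> k \<Longrightarrow> radicand k (Suc i) holomorphic_on ball 0 r"
  by (intro analytic_imp_holomorphic, subst analytic_on_analytic_at)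
     (use radicand_nonpos_disc in \<open>auto intro!: analytic_radicand\<close>)

lemma branch_type_outwards:
  assumes "i \<le> l" "l \<le> k" "norm \<rho> = r" "\<alpha> > 0"
    "branch_type (\<lambda>z. csqrt (radicand k (Suc i) z)) \<rho> \<alpha>"
    "\<And>n. i < n \<Longrightarrow> n \<le> l \<Longrightarrow> radicand k (Suc n) \<rho> \<noteq> 0"
  shows "branch_type (\<lambda>z. csqrt (radicand k (Suc l) z)) \<rho> \<alpha>"
  using assms(1,2,6)
proof (induction l rule: dec_induct)
  case base
  show ?case by fact
next
  case (step n)
  have "\<rho> \<noteq> 0" using assms(3) r_pos by auto
  show ?case
  proof (rule branch_type_csqrt)
    show "branch_type (\<lambda>z. csqrt (radicand k (Suc n) z)) \<rho> \<alpha>" using step by auto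
    show "(\<lambda>z. 1 - 4 * (of_nat k - of_nat (Suc (Suc n)) + 1) * z\<^sup>2 - 2 * z) holomorphic_on UNIV"
      by (intro holomorphic_intros)
    show "radicand k (Suc (Suc n)) z \<notin> \<real>\<^sub>\<le>\<^sub>0" if "norm z < norm \<rho>" for z
      using radicand_nonpos_disc[of "Suc n" z] that step assms(3) by simp
    show "radicand k (Suc (Suc n)) \<rho> \<notin> \<real>\<^sub>\<le>\<^sub>0"
      using radicand_nonpos_iff[of "Suc n" \<rho>] step assms(3) by simp
  qed (use \<open>\<rho> \<noteq> 0\<close> assms in \<open>simp_all only: radicand.simps not_False_eq_True\<close>)
qed

lemma H_le_has_singularity_type:
  assumes "i \<le> k" "norm \<rho> = r" "\<alpha> > 0" "\<alpha> \<notin> \<nat>"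
    "branch_type (\<lambda>z. csqrt (radicand k (Suc i) z)) \<rho> \<alpha>"
    "\<And>n. i < n \<Longrightarrow> n \<le> k \<Longrightarrow> radicand k (Suc n) \<rho> \<noteq> 0"
  shows "has_singularity_type (H_le k) \<rho> \<alpha>"
proof -
  have \<rho>: "\<rho> \<noteq> 0" using assms(2) r_pos by auto
  have "branch_type (\<lambda>z. csqrt (radicand k (Suc k) z)) \<rho> \<alpha>"
    using assms by (intro branch_type_outwards[of i k]) auto
  hence "branch_type (branch k) \<rho> \<alpha>"
    by (rule branch_type_divide[OF _ \<rho> _ one_minus_csqrt_radicand[OF order_refl]])
       (use holomorphic_branch[of k] assms(2) in simp)
  thus ?thesis
    by (rule branch_type_imp_has_singularity_type[OF _ \<rho> assms(4)])
       (simp_all add: assms(2) fps_conv_radius_H_le eval_fps_H_le)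
qed

lemma H_le_type_half:
  assumes "i \<le> k" "norm \<rho> = r" "radicand k (Suc i) \<rho> = 0"
    "\<And>n. n \<le> k \<Longrightarrow> n \<noteq> i \<Longrightarrow> radicand k (Suc n) \<rho> \<noteq> 0"
    "(radicand k (Suc i) has_field_derivative - of_real d / \<rho>) (at \<rho>)" "d > 0"
  shows "has_singularity_type (H_le k) \<rho> (1 / 2)"
proof (rule H_le_has_singularity_type[OF assms(1,2)])
  show "branch_type (\<lambda>z. csqrt (radicand k (Suc i) z)) \<rho> (1 / 2)"
  proof (rule branch_type_half[OF _ _ _ assms(3,5,6)])
    show "radicand k (Suc i) analytic_on {\<rho>}"
      using radicand_nonpos_iff assms(1,2,4) by (intro analytic_radicand) force
  qed (use assms(1,2) r_pos holomorphic_radicand[of i] radicand_nonpos_disc[of i] in auto)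
  show "(1 / 2 :: real) \<notin> \<nat>"
  proof
    assume "(1 / 2 :: real) \<in> \<nat>"
    then obtain n where "1 / 2 = real n" by (elim Nats_cases)
    hence "1 = 2 * n" by linarith
    thus False by presburger
  qed
qed (use assms(4) in auto)

lemma H_le_type_quarter:
  assumes "Suc i \<le> k" "radicand k (Suc i) (of_real r) = 0" "radicand k (Suc (Suc i)) (of_real r) = 0"
    "\<And>n. n \<le> k \<Longrightarrow> n \<noteq> i \<Longrightarrow> n \<noteq> Suc i \<Longrightarrow> radicand k (Suc n) (of_real r) \<noteq> 0"
  shows "has_singularity_type (H_le k) (of_real r) (1 / 4)"
proof (rule H_le_has_singularity_type[OF assms(1)])
  obtain d where d: "d > 0" "(radicand k (Suc i) has_field_derivative - of_real d) (at (of_real r))"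
    using radicand_derivative[of i] assms(1,4) by auto
  show "branch_type (\<lambda>z. csqrt (radicand k (Suc (Suc i)) z)) (of_real r) (1 / 4)"
  proof (rule branch_type_quarter[OF r_pos])
    show "radicand k (Suc i) analytic_on {of_real r}"
      using radicand_nonpos_iff assms(1,4) r_pos by (intro analytic_radicand) force
    \<comment> \<open>The derivative is normalized as -d / \<rho>, hence the extra factor r.\<close>
    show "(radicand k (Suc i) has_field_derivative - of_real (d * r) / of_real r) (at (of_real r))"
      using d(2) r_pos by simp
    show "(\<lambda>z. 1 - 4 * (of_nat k - of_nat (Suc (Suc i)) + 1) * z\<^sup>2 - 2 * z) holomorphic_on UNIV"
      by (intro holomorphic_intros)
    show "1 - 4 * (of_nat k - of_nat (Suc (Suc i)) + 1) * (complex_of_real r)\<^sup>2 - 2 * of_real r = 0"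
      using assms(3) unfolding radicand.simps assms(2) by simp
    show "radicand k (Suc (Suc i)) z \<notin> \<real>\<^sub>\<le>\<^sub>0" if "norm z < r" for z
      using radicand_nonpos_disc[of "Suc i" z] that assms(1) by simp
    show "radicand k (Suc i) z \<notin> \<real>\<^sub>\<le>\<^sub>0" if "norm z < r" for z
      using radicand_nonpos_disc[of i z] that assms(1) by simp
  qed (use assms(1,2) d(1) r_pos holomorphic_radicand[of i] in \<open>simp_all only: radicand.simps Suc_leD mult_pos_pos\<close>)
qed (use assms(4) r_pos quarter_not_nat in auto)

text \<open>Every point with a type lies on the circle of convergence. Away from r the radicands of
  index at least 2 do not vanish, so if R_1 did not vanish either, the branch would be analytic
  there.\<close>

lemma H_le_singularity:
  assumes "has_singularity_type (H_le k) \<rho> \<alpha>" "has_singularity_type (H_le k) \<rho>' \<beta>" "norm \<rho> = r" "\<rho>' \<noteq> of_real r"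
  shows "norm \<rho>' = r" "radicand k (Suc 0) \<rho>' = 0"
proof -
  show \<rho>': "norm \<rho>' = r" using assms(1-3) by (simp add: has_singularity_type_def)
  show "radicand k (Suc 0) \<rho>' = 0"
  proof (rule ccontr)
    assume 0: "radicand k (Suc 0) \<rho>' \<noteq> 0"
    have "radicand k (Suc l) \<rho>' \<noteq> 0" if "l \<le> k" for l
      using radicand_zero_imp[of "l - 1" \<rho>'] assms(4) that \<rho>' 0 by (cases l) auto
    hence "branch k analytic_on {\<rho>'}"
      using radicand_nonpos_iff[of _ \<rho>'] \<rho>' by (intro analytic_branch) auto
    thus False using has_singularity_type_not_analytic[OF assms(2)] eval_fps_H_le \<rho>' by blast
  qed
qed

end

lemma radicand_disc_exists:
  assumes "k \<ge> 1" "k \<in> {N_seq j..<N_seq (j + 1)}"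
  obtains r where "radicand_disc k r"
    "\<And>i. radicand k (Suc i) (of_real r) = 0 \<longleftrightarrow> Suc i = j + 1 \<or> Suc i = j \<and> k = N_seq j"
    "k = N_seq j \<Longrightarrow> r = 1 / (2 * real (u_seq j))"
proof -
  obtain y where y: "y \<ge> 1" "\<And>i. scaled_radicand k y i \<ge> 0"
    "\<And>i. scaled_radicand k y i = 0 \<longleftrightarrow> i = j + 1 \<or> i = j \<and> k = N_seq j"
    "k = N_seq j \<Longrightarrow> y = real (u_seq j)"
    using scaled_radicand_first_zero[OF assms] by blast
  define r where "r = 1 / (2 * y)"
  have r: "r > 0" "1 / (2 * r) = y" using y(1) by (auto simp: r_def)
  have inner: "radicand k (Suc i) (of_real x) = of_real (4 * x\<^sup>2 * scaled_radicand k (1 / (2 * x)) (Suc i)) \<and>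
      scaled_radicand k (1 / (2 * x)) (Suc i) > 0" if "0 < x" "x < r" for i x
  proof -
    \<comment> \<open>A smaller x means a larger y, where monotonicity makes all scaled radicands
      positive.\<close>
    have "y < 1 / (2 * x)" using that y(1) by (simp add: r_def field_simps)
    hence "scaled_radicand k (1 / (2 * x)) n > 0" for n
      using scaled_radicand_mono[OF y(1) _ y(2), of "1 / (2 * x)" n] y(2)[of n] by linarith
    thus ?thesis using radicand_of_real[of x i k] that less_imp_le by auto
  qed
  have outer: "radicand k (Suc i) (of_real r) = of_real (4 * r\<^sup>2 * scaled_radicand k y (Suc i))" for i
    using radicand_of_real[of r i k] r y(2) by simp
  show ?thesis
  proof (rule that[of r])
    show "radicand_disc k r"
    proof
      fix i x assume "0 \<le> x" "x \<le> r"
      then consider "x = 0" | "0 < x" "x < r" | "x = r" by linarith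
      thus "radicand k (Suc i) (of_real x) \<in> \<real>\<^sub>\<ge>\<^sub>0"
      proof cases
        case 2
        show ?thesis unfolding conjunct1[OF inner[OF 2]] nonneg_Reals_of_real_iff
          using conjunct2[OF inner[OF 2, of i]] by simp
      next
        case 3
        show ?thesis unfolding 3 outer nonneg_Reals_of_real_iff using y(2)[of "Suc i"] by simp
      qed simp
    next
      fix i x assume "0 \<le> x" "x < r"
      then consider "x = 0" | "0 < x" "x < r" by linarith
      thus "radicand k (Suc i) (of_real x) \<noteq> 0"
      proof cases
        case 2
        show ?thesis unfolding conjunct1[OF inner[OF 2]] of_real_eq_0_iff
          using conjunct2[OF inner[OF 2, of i]] 2 by simp
      qed simp
    qed (use assms r in auto)
    show "radicand k (Suc i) (of_real r) = 0 \<longleftrightarrow> Suc i = j + 1 \<or> Suc i = j \<and> k = N_seq j" for i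
      unfolding outer of_real_eq_0_iff using r(1) y(3)[of "Suc i"] by simp
    show "r = 1 / (2 * real (u_seq j))" if "k = N_seq j" using y(4)[OF that] by (simp add: r_def)
  qed
qed

theorem theorem2:
  fixes k j :: nat
  assumes "k \<ge> 1" and "k \<in> {N_seq j..<N_seq (j + 1)}"
  shows "(k \<noteq> N_seq j \<longrightarrow>
            {i. dominant_radicand k i} = {j + 1} \<and>
            (\<exists>\<rho>. {z. dominant_singularity (H_le k) z} = {\<rho>} \<and>
                  has_singularity_type (H_le k) \<rho> (1 / 2))) \<and>
         (k = N_seq j \<longrightarrow>
            (\<exists>\<rho>. {z. dominant_singularity (H_le k) z} = {\<rho>} \<and>
                  \<rho> = 1 / (2 * of_nat (u_seq j)) \<and>
                  radicand k j \<rho> = 0 \<and> radicand k (j + 1) \<rho> = 0 \<and>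
                  has_singularity_type (H_le k) \<rho> (1 / 4)))"
proof -
  obtain r where "radicand_disc k r"
    and zero: "\<And>i. radicand k (Suc i) (of_real r) = 0 \<longleftrightarrow> Suc i = j + 1 \<or> Suc i = j \<and> k = N_seq j"
    and r_eq: "k = N_seq j \<Longrightarrow> r = 1 / (2 * real (u_seq j))"
    using radicand_disc_exists[OF assms] by blast
  interpret radicand_disc k r by fact
  define \<rho> where "\<rho> = complex_of_real r"
  have \<rho>: "norm \<rho> = r" "\<rho> \<noteq> 0" using r_pos by (auto simp: \<rho>_def)
  \<comment> \<open>This ensures that the radicand with index j + 1 is among the k + 1 existing
    ones.\<close>
  have "j \<le> N_seq j" by (simp add: N_seq_def)
  hence jk: "j \<le> k" using assms(2) by simp
  have j: "j \<noteq> 0"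
  proof
    assume "j = 0"
    thus False using assms by (simp add: N_seq_def)
  qed
  show ?thesis
  proof (intro conjI impI)
    assume k: "k \<noteq> N_seq j"
    obtain d where d: "d > 0" "(radicand k (Suc j) has_field_derivative - of_real d) (at (of_real r))"
      using radicand_derivative[of j] jk zero k by auto
    have type: "has_singularity_type (H_le k) \<rho> (1 / 2)"
    proof (rule H_le_type_half[OF jk \<rho>(1)])
      show "(radicand k (Suc j) has_field_derivative - of_real (d * r) / \<rho>) (at \<rho>)"
        using d(2) r_pos by (simp add: \<rho>_def)
    qed (use zero k d(1) r_pos in \<open>auto simp: \<rho>_def\<close>)
    have dom: "{z. dominant_singularity (H_le k) z} = {\<rho>}"
    proof (rule dominant_singularity_unique[OF type])
      fix \<rho>' \<beta> assume *: "has_singularity_type (H_le k) \<rho>' \<beta>" "\<rho>' \<noteq> \<rho>"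
      hence "norm \<rho>' = r" "radicand k (Suc 0) \<rho>' = 0"
        using H_le_singularity[OF type *(1) \<rho>(1)] by (auto simp: \<rho>_def)
      \<comment> \<open>By majorization a zero of R_1 on the circle forces one at r, which is
        impossible for j \<ge> 1 and k \<noteq> N_j.\<close>
      hence "rval 0 r = 0"
        using norm_one_minus_radicand_le[of 0 \<rho>'] rval_nonneg[of 0 r] r_pos by simp
      hence "radicand k (Suc 0) (of_real r) = 0" using radicand_eq_rval[of 0 r] r_pos by simp
      thus "1 / 2 < \<beta>" using zero[of 0] j k by simp
    qed
    have "dominant_radicand k i \<longleftrightarrow> i = j + 1" for i
    proof -
      have "dominant_singularity (H_le k) z \<longleftrightarrow> z = \<rho>" for z using dom by blast
      hence "dominant_radicand k i \<longleftrightarrow> i \<in> {1..k + 1} \<and> radicand k i \<rho> = 0"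
        by (simp add: dominant_radicand_def)
      thus ?thesis using zero[of "i - 1"] k jk by (cases i) (auto simp: \<rho>_def)
    qed
    thus "{i. dominant_radicand k i} = {j + 1}" by blast
    show "\<exists>\<rho>. {z. dominant_singularity (H_le k) z} = {\<rho>} \<and> has_singularity_type (H_le k) \<rho> (1 / 2)"
      using dom type by blast
  next
    assume k: "k = N_seq j"
    obtain i where i: "j = Suc i" using j not0_implies_Suc by blast
    have zeros: "radicand k j \<rho> = 0" "radicand k (j + 1) \<rho> = 0"
      using zero[of i] zero[of j] k i by (auto simp: \<rho>_def)
    have type: "has_singularity_type (H_le k) \<rho> (1 / 4)"
      unfolding \<rho>_def
      by (rule H_le_type_quarter[of i]) (use zeros zero jk i in \<open>auto simp: \<rho>_def\<close>)
    have "{z. dominant_singularity (H_le k) z} = {\<rho>}"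
    proof (rule dominant_singularity_unique[OF type])
      fix \<rho>' \<beta> assume *: "has_singularity_type (H_le k) \<rho>' \<beta>" "\<rho>' \<noteq> \<rho>"
      hence \<rho>': "norm \<rho>' = r" "radicand k (Suc 0) \<rho>' = 0"
        using H_le_singularity[OF type *(1) \<rho>(1)] by (auto simp: \<rho>_def)
      hence "rval 0 r = 0"
        using norm_one_minus_radicand_le[of 0 \<rho>'] rval_nonneg[of 0 r] r_pos by simp
      hence "radicand k (Suc 0) (of_real r) = 0" using radicand_eq_rval[of 0 r] r_pos by simp
      \<comment> \<open>Only when the simultaneous zeros include R_1 can another singular point
        exist; this leaves k = N_1 = 1 and r = 1/2.\<close>
      hence j1: "j = 1" using zero[of 0] j by simp
      hence k1: "k = 1" "r = 1 / 2" using k r_eq by (auto simp: N_seq_def)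
      have "(\<rho>' - 1 / 2) * (\<rho>' + 1 / 2) = 0"
        using \<rho>'(2) k1 by (simp add: algebra_simps power2_eq_square)
      hence \<rho>'_eq: "\<rho>' = - 1 / 2" using *(2) k1 by (auto simp: \<rho>_def eq_neg_iff_add_eq_0)
      have "has_singularity_type (H_le k) \<rho>' (1 / 2)"
      proof (rule H_le_type_half)
        \<comment> \<open>The derivative -8 z has the value 4 at -1/2, which is -d / \<rho>' for d =
          2.\<close>
        have "radicand k (Suc 0) = (\<lambda>z. 1 - 4 * z\<^sup>2)" using k1 by (simp add: fun_eq_iff)
        thus "(radicand k (Suc 0) has_field_derivative - of_real 2 / \<rho>') (at \<rho>')"
          using \<rho>'_eq by (auto intro!: derivative_eq_intros)
        show "radicand k (Suc n) \<rho>' \<noteq> 0" if "n \<le> k" "n \<noteq> 0" for n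
          using radicand_zero_imp[of "n - 1" \<rho>'] that \<rho>' *(2) by (cases n) (auto simp: \<rho>_def)
      qed (use \<rho>' in auto)
      hence "\<beta> = 1 / 2" using has_singularity_type_unique *(1) by blast
      thus "1 / 4 < \<beta>" by simp
    qed
    moreover have "\<rho> = 1 / (2 * of_nat (u_seq j))" using r_eq[OF k] by (simp add: \<rho>_def)
    ultimately show "\<exists>\<rho>. {z. dominant_singularity (H_le k) z} = {\<rho>} \<and>
                  \<rho> = 1 / (2 * of_nat (u_seq j)) \<and>
                  radicand k j \<rho> = 0 \<and> radicand k (j + 1) \<rho> = 0 \<and>
                  has_singularity_type (H_le k) \<rho> (1 / 4)"
      using zeros type by blast
  qed
qed

end
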